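(* Let $(\Omega,\mathcal F,\mathbb P)$ be a probability space, let $d,\mathfrak d,K,M\in\mathbb N$, $\varepsilon\in(0,\infty)$, $L,u\in\mathbb R$, $v\in(u,\infty)$, let $D\subseteq\mathbb R^d$ be a compact set with at least two elements, let $X_m\colon\Omega\to D$ and $Y_m\colon\Omega\to[u,v]$, $m\in\{1,\dots,M\}$, be functions such that $(X_m,Y_m)$, $m\in\{1,\dots,M\}$, are i.i.d. random variables, let $\delta\colon D\times D\to[0,\infty)$ be $\delta(x,y)=\sum_{i=1}^d|x_i-y_i|$, let $\varphi\colon D\to[u,v]$ satisfy $\mathbb P$-a.s. $\varphi(X_1)=\mathbb E[Y_1|X_1]$ and $|\varphi(x)-\varphi(y)|\le L\delta(x,y)$ for all $x,y\in D$, let $N\in\mathbb N\cap[\max\{2,\mathcal C_{(D,\delta),\varepsilon/(4L)}\},\infty)$, let $l\in\mathbb N\cap(N,\infty)$, let $\mathfrak l=(\mathfrak l_0,\dots,\mathfrak l_l)\in\mathbb N^{l+1}$ satisfy $\mathfrak l_0=d$, $\mathfrak l_1\ge 2dN$, $\mathfrak l_i\ge 2N-2i+3$ for all $i\in\mathbb N\cap[2,N]$, $\mathfrak l_j\ge 2$ for all $j\in\mathbb N\cap[N,l)$, $\mathfrak l_l=1$ and $\sum_{k=1}^l\mathfrak l_k(\mathfrak l_{k-1}+1)\le\mathfrak d$, let $R\in[\max\{1,L,\sup_{z\in D}\|z\|_\infty,2\sup_{z\in D}|\varphi(z)|\},\infty)$, let $B=[-R,R]^{\mathfrak d}$, let $\mathfrak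 E\colon B\times\Omega\to[0,\infty)$ be $\mathfrak E(\theta,\omega)=\frac1M\sum_{m=1}^M|\mathscr N^{\theta,\mathfrak l}_{u,v}(X_m(\omega))-Y_m(\omega)|^2$, let $\Theta_k\colon\Omega\to B$, $k\in\{1,\dots,K\}$, be i.i.d. random variables with $\Theta_1$ continuous uniformly distributed on $B$, and let $\Xi=\Theta_{k^*}$ with $k^*=\min\{k\in\{1,\dots,K\}\colon\mathfrak E(\Theta_k)=\min_{j\in\{1,\dots,K\}}\mathfrak E(\Theta_j)\}$. Then $$\mathbb P\Bigl(\int_D|\mathscr N^{\Xi,\mathfrak l}_{u,v}(x)-\varphi(x)|^2\,\mathbb P_{X_1}(dx)>\varepsilon^2\Bigr)\le\exp\Bigl(-K\min\Bigl\{1,\frac{\varepsilon^{2\mathfrak d}}{(16(v-u)l(\|\mathfrak l\|_\infty+1)^lR^{l+1})^{\mathfrak d}}\Bigr\}\Bigr)+2\exp\Bigl(\mathfrak d\ln\Bigl(\max\Bigl\{1,\frac{128l(\|\mathfrak l\|_\infty+1)^lR^{l+1}(v-u)}{\varepsilon^2}\Bigr\}\Bigr)-\frac{\varepsilon^4M}{32(v-u)^4}\Bigr).$$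
   Context: Covering number: for a metric space $(E,\delta)$ and $r\in[0,\infty]$, $\mathcal C_{(E,\delta),r}=\inf(\{n\in\mathbb N_0\colon\exists A\subseteq E \text{ with } |A|\le n \text{ and } \forall x\in E\ \exists a\in A\colon\delta(a,x)\le r\}\cup\{\infty\})$. Max norm: $\|\theta\|_\infty=\max_i|\theta_i|$ for $\theta\in\mathbb R^n$ (also applied to tuples of natural numbers). Clipped ReLU networks: for $r,s\in\mathbb N$, $k\in\mathbb N_0$, $\theta\in\mathbb R^{\mathfrak d}$ with $\mathfrak d\ge k+rs+r$, $\mathcal A^{\theta,k}_{r,s}\colon\mathbb R^s\to\mathbb R^r$ has $i$-th component $x\mapsto\sum_{j=1}^s\theta_{k+(i-1)s+j}x_j+\theta_{k+rs+i}$. For $u\in[-\infty,\infty)$, $v\in(u,\infty]$, $\mathfrak C_{u,v,n}$ applies $y\mapsto\max\{u,\min\{y,v\}\}$ componentwise on $\mathbb R^n$ and $\mathfrak R_n$ applies $y\mapsto\max\{y,0\}$ componentwise. For $L\in\mathbb N$, $l=(l_0,\dots,l_L)\in\mathbb N^{L+1}$, $\theta\in\mathbb R^{\mathfrak d}$ with $\mathfrak d\ge\sum_{k=1}^Ll_k(l_{k-1}+1)$, set $s_k=\sum_{j=1}^kl_j(l_{j-1}+1)$ and $\mathscr N^{\theta,l}_{u,v}=\mathfrak C_{u,v,l_L}\circ\mathcal A^{\theta,s_{L-1}}_{l_L,l_{L-1}}\circ\mathfrak R_{l_{L-1}}\circ\mathcal A^{\theta,s_{L-2}}_{l_{L-1},l_{L-2}}\circ\cdots\circ\mathfrak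 R_{l_1}\circ\mathcal A^{\theta,0}_{l_1,l_0}\colon\mathbb R^{l_0}\to\mathbb R^{l_L}$ (for $L=1$ just $\mathfrak C_{u,v,l_1}\circ\mathcal A^{\theta,0}_{l_1,l_0}$). *)

theory Defs
  imports "HOL-Analysis.Analysis" "HOL-Probability.Probability"
begin

text \<open>Vectors in R^n are represented as extensional functions on the index set {1..n}
  (i.e. elements of PiE {1..n} (\<lambda>_. UNIV)), the usual representation of HOL-Probability.\<close>

definition covering_number :: "'a set \<Rightarrow> ('a \<Rightarrow> 'a \<Rightarrow> real) \<Rightarrow> ereal \<Rightarrow> enat" where
  "covering_number E \<delta> r =
     Inf ({enat n | n. \<exists>A. A \<subseteq> E \<and> finite A \<and> card A \<le> n \<and>
                             (\<forall>x\<in>E. \<exists>a\<in>A. ereal (\<delta> a x) \<le> r)} \<union> {\<infinity>})"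

definition affine_map :: "(nat \<Rightarrow> real) \<Rightarrow> nat \<Rightarrow> nat \<Rightarrow> nat \<Rightarrow> (nat \<Rightarrow> real) \<Rightarrow> (nat \<Rightarrow> real)" where
  "affine_map \<theta> k r s x =
     restrict (\<lambda>i. (\<Sum>j=1..s. \<theta> (k + (i - 1) * s + j) * x j) + \<theta> (k + r * s + i)) {1..r}"

definition relu_vec :: "nat \<Rightarrow> (nat \<Rightarrow> real) \<Rightarrow> (nat \<Rightarrow> real)" where
  "relu_vec n y = restrict (\<lambda>i. max (y i) 0) {1..n}"

definition clip_vec :: "real \<Rightarrow> real \<Rightarrow> nat \<Rightarrow> (nat \<Rightarrow> real) \<Rightarrow> (nat \<Rightarrow> real)" where
  "clip_vec u v n y = restrict (\<lambda>i. max u (min (y i) v)) {1..n}"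

definition param_count :: "(nat \<Rightarrow> nat) \<Rightarrow> nat \<Rightarrow> nat" where
  "param_count ll k = (\<Sum>j=1..k. ll j * (ll (j - 1) + 1))"

fun hidden_layers :: "(nat \<Rightarrow> real) \<Rightarrow> (nat \<Rightarrow> nat) \<Rightarrow> nat \<Rightarrow> (nat \<Rightarrow> real) \<Rightarrow> (nat \<Rightarrow> real)" where
  "hidden_layers \<theta> ll 0 x = x"
| "hidden_layers \<theta> ll (Suc k) x =
     relu_vec (ll (Suc k)) (affine_map \<theta> (param_count ll k) (ll (Suc k)) (ll k) (hidden_layers \<theta> ll k x))"

definition clipped_net :: "(nat \<Rightarrow> real) \<Rightarrow> (nat \<Rightarrow> nat) \<Rightarrow> nat \<Rightarrow> real \<Rightarrow> real \<Rightarrow> (nat \<Rightarrow> real) \<Rightarrow> (nat \<Rightarrow> real)" where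
  "clipped_net \<theta> ll L u v x =
     clip_vec u v (ll L)
       (affine_map \<theta> (param_count ll (L - 1)) (ll L) (ll (L - 1)) (hidden_layers \<theta> ll (L - 1) x))"

end

theory Submission
  imports Defs
begin

text \<open>Let \<open>\<R>(\<theta>)\<close> be the expected and \<open>\<E>(\<theta>)\<close> the empirical quadratic risk. As \<open>\<phi>(X)\<close> is the
  conditional expectation of \<open>Y\<close> given \<open>X\<close>, the squared \<open>L\<^sup>2\<close>-distance of the network to \<open>\<phi>\<close> is
  \<open>\<R>(\<theta>)\<close> minus the risk of \<open>\<phi>\<close>. For a fixed parameter \<open>\<eta>\<close> in the cube, the squared error of
  \<open>\<Xi>\<close> therefore is at most the squared error of \<open>\<eta>\<close>, plus \<open>\<E>(\<Xi>) - \<E>(\<eta>)\<close>, plus twice the uniform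
  distance of \<open>\<E>\<close> and \<open>\<R>\<close>; it suffices to bound these by \<open>\<epsilon>\<^sup>2/4\<close>, \<open>\<epsilon>\<^sup>2/4\<close> and \<open>\<epsilon>\<^sup>2/2\<close>.

  For the first term, \<open>\<eta>\<close> realises \<open>max\<^sub>k (\<phi>(a\<^sub>k) - L \<delta>(x, a\<^sub>k))\<close> for the centres \<open>a\<^sub>k\<close> of a cover of
  \<open>D\<close>. For the other two, the network is Lipschitz in \<open>\<theta>\<close> with constant
  \<open>\<Lambda> = l (\<parallel>l\<parallel> + 1)\<^sup>l R\<^sup>l\<close>. Hence the second term is small as soon as one of the independent uniform
  samples hits a small cube around \<open>\<eta>\<close>, and for the third a union bound over a grid combined with
  Hoeffding's inequality suffices.\<close>

section \<open>Realising prescribed weights and biases\<close>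

lemma param_count_0 [simp]: "param_count ll 0 = 0"
  by (simp add: param_count_def)

lemma param_count_Suc [simp]: "param_count ll (Suc k) = param_count ll k + ll (Suc k) * (ll k + 1)"
  by (simp add: param_count_def)

lemma param_count_mono: "j \<le> k \<Longrightarrow> param_count ll j \<le> param_count ll k"
  by (induction k rule: dec_induct) auto

text \<open>Different layers read disjoint blocks of the parameter vector, the one for layer
  \<open>Suc k\<close> starting right after \<open>param_count ll k\<close>. Hence the layers can be
  prescribed one after the other, each time changing only the indices beyond
  \<open>param_count ll l\<close>.\<close>

lemma exists_parameters_aux:
  fixes W :: "nat \<Rightarrow> nat \<Rightarrow> nat \<Rightarrow> real" and b :: "nat \<Rightarrow> nat \<Rightarrow> real"
  assumes W: "\<And>k i j. \<bar>W k i j\<bar> \<le> R" and b: "\<And>k i. \<bar>b k i\<bar> \<le> R"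
  shows "\<exists>\<theta>. (\<forall>p. \<bar>\<theta> p\<bar> \<le> R) \<and>
    (\<forall>k<l. \<forall>i\<in>{1..ll (Suc k)}. (\<forall>j\<in>{1..ll k}. \<theta> (param_count ll k + (i - 1) * ll k + j) = W (Suc k) i j) \<and>
            \<theta> (param_count ll k + ll (Suc k) * ll k + i) = b (Suc k) i)"
proof (induction l)
  case 0
  have "0 \<le> R" using b[of 0 0] by linarith
  then show ?case by (intro exI[of _ "\<lambda>_. 0"]) auto
next
  case (Suc l)
  then obtain \<theta> where \<theta>: "\<And>p. \<bar>\<theta> p\<bar> \<le> R"
    "\<And>k i j. k < l \<Longrightarrow> i \<in> {1..ll (Suc k)} \<Longrightarrow> j \<in> {1..ll k} \<Longrightarrow> \<theta> (param_count ll k + (i - 1) * ll k + j) = W (Suc k) i j"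
    "\<And>k i. k < l \<Longrightarrow> i \<in> {1..ll (Suc k)} \<Longrightarrow> \<theta> (param_count ll k + ll (Suc k) * ll k + i) = b (Suc k) i"
    by blast
  let ?r = "ll (Suc l)" and ?s = "ll l"
  \<comment> \<open>\<open>q\<close> is the zero-based position inside the new block. Its first
    \<open>?r * ?s\<close> entries are the weights row by row, so row and column are recovered by
    \<open>div\<close> and \<open>mod\<close> and shifted back by 1; the biases follow.\<close>
  define \<theta>' where "\<theta>' p = (if p \<le> param_count ll l then \<theta> p else
      let q = p - param_count ll l - 1 in
      if q < ?r * ?s then W (Suc l) (q div ?s + 1) (q mod ?s + 1) else b (Suc l) (q - ?r * ?s + 1))" for p
  have idx: "(i - 1) * s + j \<le> r * s" if "i \<in> {1..r}" "j \<in> {1..s}" for i j r s :: nat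
  proof -
    have "(i - 1) * s + j \<le> (i - 1) * s + s" using that by simp
    also have "\<dots> = i * s" using that by (cases i) auto
    also have "\<dots> \<le> r * s" using that by simp
    finally show ?thesis .
  qed
  show ?case
  proof (intro exI[of _ \<theta>'] conjI allI impI ballI)
    show "\<bar>\<theta>' p\<bar> \<le> R" for p by (simp add: \<theta>'_def Let_def \<theta>(1) W b)
  next
    fix k i j assume k: "k < Suc l" and i: "i \<in> {1..ll (Suc k)}" and j: "j \<in> {1..ll k}"
    show "\<theta>' (param_count ll k + (i - 1) * ll k + j) = W (Suc k) i j"
    proof (cases "k < l")
      case True
      then have "param_count ll (Suc k) \<le> param_count ll l" by (intro param_count_mono) auto
      then show ?thesis using True idx[OF i j] \<theta>(2)[OF True i j] by (simp add: \<theta>'_def)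
    next
      case False
      then have kl: "k = l" using k by simp
      define q where "q = (i - 1) * ?s + (j - 1)"
      have q: "param_count ll k + (i - 1) * ll k + j = Suc (param_count ll l + q)"
        using j by (simp add: q_def kl)
      have "Suc q = (i - 1) * ?s + j" using j by (simp add: q_def)
      then have "q < ?r * ?s" using idx[OF i j] unfolding kl by linarith
      moreover have "q div ?s = i - 1" "q mod ?s = j - 1" using j by (cases j; simp add: q_def kl)+
      ultimately show ?thesis using i j unfolding q by (simp add: \<theta>'_def kl)
    qed
  next
    fix k i assume k: "k < Suc l" and i: "i \<in> {1..ll (Suc k)}"
    show "\<theta>' (param_count ll k + ll (Suc k) * ll k + i) = b (Suc k) i"
    proof (cases "k < l")
      case True
      then have "param_count ll (Suc k) \<le> param_count ll l" by (intro param_count_mono) auto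
      then show ?thesis using True i \<theta>(3)[OF True i] by (simp add: \<theta>'_def)
    next
      case False
      then have kl: "k = l" using k by simp
      have q: "param_count ll k + ll (Suc k) * ll k + i = Suc (param_count ll l + (?r * ?s + (i - 1)))"
        using i by (simp add: kl)
      show ?thesis using i unfolding q by (cases i) (simp_all add: \<theta>'_def Let_def kl)
    qed
  qed
qed

text \<open>Every index read by the first \<open>l\<close> layers is at most
  \<open>param_count ll l\<close>, hence at most \<open>dd\<close>. Restricting to
  \<open>{1..dd}\<close> therefore changes no affine map and gives a point of the extensional
  cube.\<close>

lemma exists_parameters:
  fixes W :: "nat \<Rightarrow> nat \<Rightarrow> nat \<Rightarrow> real" and b :: "nat \<Rightarrow> nat \<Rightarrow> real"
  assumes W: "\<And>k i j. \<bar>W k i j\<bar> \<le> R" and b: "\<And>k i. \<bar>b k i\<bar> \<le> R"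
    and dd: "param_count ll l \<le> dd"
  obtains \<theta> where "\<theta> \<in> PiE {1..dd} (\<lambda>_. {-R..R})"
    "\<And>k x. k < l \<Longrightarrow> affine_map \<theta> (param_count ll k) (ll (Suc k)) (ll k) x =
        restrict (\<lambda>i. (\<Sum>j=1..ll k. W (Suc k) i j * x j) + b (Suc k) i) {1..ll (Suc k)}"
proof -
  obtain \<theta> where \<theta>: "\<And>p. \<bar>\<theta> p\<bar> \<le> R"
    "\<And>k i j. k < l \<Longrightarrow> i \<in> {1..ll (Suc k)} \<Longrightarrow> j \<in> {1..ll k} \<Longrightarrow> \<theta> (param_count ll k + (i - 1) * ll k + j) = W (Suc k) i j"
    "\<And>k i. k < l \<Longrightarrow> i \<in> {1..ll (Suc k)} \<Longrightarrow> \<theta> (param_count ll k + ll (Suc k) * ll k + i) = b (Suc k) i"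
    using exists_parameters_aux[of W R b l ll] W b by blast
  define \<theta>' where "\<theta>' = restrict \<theta> {1..dd}"
  show ?thesis
  proof
    show "\<theta>' \<in> PiE {1..dd} (\<lambda>_. {-R..R})" using \<theta>(1) by (auto simp: \<theta>'_def abs_le_iff minus_le_iff)
    fix k x assume k: "k < l"
    have le: "param_count ll k + ll (Suc k) * (ll k + 1) \<le> dd"
      using param_count_mono[of "Suc k" l ll] k dd by simp
    have eq: "\<theta>' (param_count ll k + (i - 1) * ll k + j) = W (Suc k) i j"
      if "i \<in> {1..ll (Suc k)}" "j \<in> {1..ll k}" for i j
    proof -
      have "(i - 1) * ll k + j \<le> (i - 1) * ll k + ll k" using that by simp
      also have "\<dots> = i * ll k" using that by (cases i) auto
      also have "\<dots> \<le> ll (Suc k) * ll k" using that by simp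
      finally show ?thesis using that \<theta>(2)[OF k that] le by (simp add: \<theta>'_def)
    qed
    have "\<theta>' (param_count ll k + ll (Suc k) * ll k + i) = b (Suc k) i" if "i \<in> {1..ll (Suc k)}" for i
      using that \<theta>(3)[OF k that] le by (simp add: \<theta>'_def)
    then show "affine_map \<theta>' (param_count ll k) (ll (Suc k)) (ll k) x =
        restrict (\<lambda>i. (\<Sum>j=1..ll k. W (Suc k) i j * x j) + b (Suc k) i) {1..ll (Suc k)}"
      using eq by (auto simp: affine_map_def intro!: restrict_ext sum.cong)
  qed
qed

section \<open>Maxima as ReLU networks\<close>

text \<open>A unit row vector: with it, a row of a weight matrix is written as the linear form that
  it computes.\<close>

definition pick :: "nat \<Rightarrow> nat \<Rightarrow> real" where "pick c j = (if j = c then 1 else 0)"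

lemma sum_pick: "(\<Sum>j=1..s. pick c j * x j) = (if c \<in> {1..s} then x c else 0)"
  by (simp add: pick_def if_distrib[of "\<lambda>t. t * _"] cong: if_cong)

text \<open>The simplifier turns the lower summation bound 1 into \<open>Suc 0\<close>, so
  \<open>sum_pick\<close> is supplied in that form.\<close>

lemmas sparse_sum = ring_distribs sum.distrib sum_subtractf sum_negf sum_pick[unfolded One_nat_def]

text \<open>In layer \<open>k\<close> with \<open>2 \<le> k \<le> N\<close>, neuron \<open>1\<close> carries the positive part of
  \<open>max {y 1, \<dots>, y (k - 1)} - y k\<close>, and the neurons \<open>2 (j - k) + 2\<close> and \<open>2 (j - k) + 3\<close> carry the
  positive and the negative part of \<open>y j\<close> for \<open>k \<le> j \<le> N\<close>. The identity
  \<open>max a b = (a - b)\<^sup>+ + b\<^sup>+ - b\<^sup>-\<close> yields the weights into the next layer. From layer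
  \<open>N + 1\<close> on, the first two neurons carry the positive and the negative part of the maximum.\<close>

definition max_weight :: "nat \<Rightarrow> nat \<Rightarrow> nat \<Rightarrow> nat \<Rightarrow> real" where
  "max_weight N k i j =
    (if k \<le> N then
       if i = 1 then pick 1 j + pick 2 j - pick 3 j - pick 4 j + pick 5 j
       else if even i then pick (i + 2) j - pick (i + 3) j else pick (i + 2) j - pick (i + 1) j
     else if k = N + 1 then if i = 1 then pick 1 j + pick 2 j - pick 3 j else pick 3 j - pick 1 j - pick 2 j
     else if i = 1 then pick 1 j - pick 2 j else pick 2 j - pick 1 j)"

text \<open>Each row is a signed sum of indicators of distinct columns. As \<open>R\<close> will be
  at least 1, the weights of the maximum layers are thus admissible.\<close>

lemma abs_max_weight_le: "\<bar>max_weight N k i j\<bar> \<le> 1"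
proof -
  have "\<bar>pick 1 j + pick 2 j - pick 3 j - pick 4 j + pick 5 j\<bar> \<le> 1"
    "\<bar>pick 1 j + pick 2 j - pick 3 j\<bar> \<le> 1" "\<bar>pick 3 j - pick 1 j - pick 2 j\<bar> \<le> 1"
    by (cases "j \<in> {1, 2, 3, 4, 5}"; auto simp: pick_def)+
  moreover have "\<bar>pick a j - pick b j\<bar> \<le> 1" for a b by (simp add: pick_def)
  ultimately show ?thesis unfolding max_weight_def by presburger
qed

text \<open>The invariant of the layers up to \<open>N\<close>, by induction on the layer. The
  activations \<open>h\<close> are abstract and subject only to the recursion and the values in
  layer 2, which separates the combinatorics from the storage of parameters.\<close>

lemma max_layers:
  fixes h :: "nat \<Rightarrow> nat \<Rightarrow> real" and y :: "nat \<Rightarrow> real"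
  assumes step: "\<And>k i. 2 \<le> k \<Longrightarrow> Suc k < l \<Longrightarrow> i \<in> {1..s (Suc k)} \<Longrightarrow>
             h (Suc k) i = max (\<Sum>j=1..s k. max_weight N (Suc k) i j * h k j) 0"
    and s_mid: "\<And>i. i \<in> {2..N} \<Longrightarrow> int (s i) \<ge> 2 * int N - 2 * int i + 3"
    and base: "h 2 1 = max (y 1 - y 2) 0"
      "\<And>k. k \<in> {2..N} \<Longrightarrow> h 2 (2 * (k - 2) + 2) = max (y k) 0 \<and> h 2 (2 * (k - 2) + 3) = max (- y k) 0"
    and i: "2 \<le> i" "i \<le> N" "i < l"
  shows "h i 1 = max (Max (y ` {1..i-1}) - y i) 0 \<and>
     (\<forall>k\<in>{i..N}. h i (2 * (k - i) + 2) = max (y k) 0 \<and> h i (2 * (k - i) + 3) = max (- y k) 0)"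
  using i
proof (induction i rule: dec_induct)
  case base
  then show ?case using assms(3,4) by auto
next
  case (step i)
  \<comment> \<open>One neuron for the running maximum and two for each of the
    \<open>N - i + 1\<close> values from \<open>y i\<close> to \<open>y N\<close> make up exactly
    this width.\<close>
  have si: "2 * (N - i) + 3 \<le> s i" using s_mid[of i] step by auto
  have si': "2 * (N - Suc i) + 3 \<le> s (Suc i)" using s_mid[of "Suc i"] step by auto
  have IH: "h i 1 = max (Max (y ` {1..i-1}) - y i) 0"
      "\<And>k. k\<in>{i..N} \<Longrightarrow> h i (2 * (k - i) + 2) = max (y k) 0"
      "\<And>k. k\<in>{i..N} \<Longrightarrow> h i (2 * (k - i) + 3) = max (- y k) 0"
    using step by auto
  have Mx: "Max (y ` {1..i}) = max (Max (y ` {1..i-1})) (y i)"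
  proof -
    have "{1..i} = insert i {1..i-1}" using step by auto
    moreover have "{1..i-1} \<noteq> {}" using step by auto
    ultimately show ?thesis by (simp add: max.commute)
  qed
  have e: "2 * (i - i) + 2 = (2::nat)" "2 * (Suc i - i) + 2 = (4::nat)"
    "2 * (i - i) + 3 = (3::nat)" "2 * (Suc i - i) + 3 = (5::nat)" for i by simp_all
  have bnd: "2 \<le> i" "Suc i \<le> N" "Suc i < l" using step.hyps step.prems by auto
  have s5: "5 \<le> s i" "1 \<le> s (Suc i)" using si si' bnd by arith+
  have mem: "i \<in> {i..N}" "Suc i \<in> {i..N}" using step by auto
  have vals: "h i 2 = max (y i) 0" "h i 3 = max (- y i) 0"
    "h i 4 = max (y (Suc i)) 0" "h i 5 = max (- y (Suc i)) 0"
    by (fact IH(2)[OF mem(1), unfolded e] IH(3)[OF mem(1), unfolded e]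
      IH(2)[OF mem(2), unfolded e] IH(3)[OF mem(2), unfolded e])+
  show ?case
  proof (intro conjI ballI)
    have "h (Suc i) 1 = max (h i 1 + h i 2 - h i 3 - h i 4 + h i 5) 0"
      using assms(1)[of i 1] bnd s5 by (simp add: max_weight_def sparse_sum)
    \<comment> \<open>The first three terms form the maximum including \<open>y i\<close>; the last
      two subtract \<open>y (Suc i)\<close>, again as positive minus negative part.\<close>
    also have "h i 1 + h i 2 - h i 3 - h i 4 + h i 5 = Max (y ` {1..i}) - y (Suc i)"
      unfolding vals IH(1) Mx by auto
    finally show "h (Suc i) 1 = max (Max (y ` {1..Suc i - 1}) - y (Suc i)) 0" by simp
  next
    fix k assume k: "k \<in> {Suc i..N}"
    \<comment> \<open>From one layer to the next, the pair of neurons belonging to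
      \<open>y k\<close> moves down by two places, from \<open>n + 4\<close> and
      \<open>n + 5\<close> to \<open>n + 2\<close> and \<open>n + 3\<close>. Since \<open>n\<close>
      is even, the parity test in \<open>max_weight\<close> tells the two apart.\<close>
    define n where "n = 2 * (k - Suc i)"
    have n: "2 * (k - i) = n + 2" "2 * (k - Suc i) = n" and ev: "even n" using k by (auto simp: n_def)
    have nle: "n + 3 \<le> s (Suc i)" "n + 5 \<le> s i"
      using k si si' unfolding n_def atLeastAtMost_iff by arith+
    have e': "n + 2 + 2 = n + 4" "n + 2 + 3 = n + 5" by simp_all
    have k': "k \<in> {i..N}" using k by auto
    have IHk: "h i (n + 4) = max (y k) 0" "h i (n + 5) = max (- y k) 0"
      by (fact IH(2)[OF k', unfolded n e'] IH(3)[OF k', unfolded n e'])+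
    have Suc_i: "Suc i < l" "n + 2 \<in> {1..s (Suc i)}" "n + 3 \<in> {1..s (Suc i)}"
      using bnd nle by auto
    have w: "max_weight N (Suc i) (n + 2) j = pick (n + 4) j - pick (n + 5) j"
      "max_weight N (Suc i) (n + 3) j = pick (n + 5) j - pick (n + 4) j" for j
      using bnd(2) ev by (auto simp: max_weight_def pick_def)
    have r: "n + 4 \<in> {1..s i}" "n + 5 \<in> {1..s i}" using nle by auto
    show "h (Suc i) (2 * (k - Suc i) + 2) = max (y k) 0"
      unfolding n assms(1)[OF bnd(1) Suc_i(1,2)] w left_diff_distrib sum_subtractf sum_pick
        if_P[OF r(1)] if_P[OF r(2)] IHk by auto
    show "h (Suc i) (2 * (k - Suc i) + 3) = max (- y k) 0"
      unfolding n assms(1)[OF bnd(1) Suc_i(1,3)] w left_diff_distrib sum_subtractf sum_pick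
        if_P[OF r(1)] if_P[OF r(2)] IHk by auto
  qed
qed

text \<open>Stated before the activation, because the last affine map is followed by clipping and
  not by ReLU: \<open>Suc k = l\<close> is the case used for the output. The smaller
  \<open>k\<close> serve the induction, in which the maximum is passed on as the difference of its
  positive and negative part, for any depth beyond \<open>N\<close>.\<close>

lemma max_output:
  fixes h :: "nat \<Rightarrow> nat \<Rightarrow> real" and y :: "nat \<Rightarrow> real"
  assumes step: "\<And>k i. 2 \<le> k \<Longrightarrow> Suc k < l \<Longrightarrow> i \<in> {1..s (Suc k)} \<Longrightarrow>
             h (Suc k) i = max (\<Sum>j=1..s k. max_weight N (Suc k) i j * h k j) 0"
    and s_mid: "\<And>i. i \<in> {2..N} \<Longrightarrow> int (s i) \<ge> 2 * int N - 2 * int i + 3"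
    and s_tail: "\<And>j. j \<in> {N..<l} \<Longrightarrow> s j \<ge> 2"
    and base: "h 2 1 = max (y 1 - y 2) 0"
      "\<And>k. k \<in> {2..N} \<Longrightarrow> h 2 (2 * (k - 2) + 2) = max (y k) 0 \<and> h 2 (2 * (k - 2) + 3) = max (- y k) 0"
    and N: "2 \<le> N" "N \<le> k" "k < l" and i: "i \<in> {1,2}"
  shows "(\<Sum>j=1..s k. max_weight N (Suc k) i j * h k j) = (if i = 1 then 1 else - 1) * Max (y ` {1..N})"
  using N(2,3) i
proof (induction k arbitrary: i rule: dec_induct)
  case base
  \<comment> \<open>In layer \<open>N\<close> only \<open>y N\<close> is still waiting, so three
    neurons carry all the information.\<close>
  have l: "h N 1 = max (Max (y ` {1..N-1}) - y N) 0 \<and>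
     (\<forall>k\<in>{N..N}. h N (2 * (k - N) + 2) = max (y k) 0 \<and> h N (2 * (k - N) + 3) = max (- y k) 0)"
    by (rule max_layers[of l s h N y N, OF assms(1,2,4,5)]) (use N base in auto)
  have e: "2 * (N - N) + 2 = (2::nat)" "2 * (N - N) + 3 = (3::nat)" by simp_all
  have l': "h N 1 = max (Max (y ` {1..N-1}) - y N) 0" "h N 2 = max (y N) 0" "h N 3 = max (- y N) 0"
    using l e by (metis atLeastAtMost_singleton singletonI)+
  have "{1..N} = insert N {1..N-1}" "{1..N-1} \<noteq> {}" using N by auto
  then have Mx: "Max (y ` {1..N}) = max (Max (y ` {1..N-1})) (y N)" by (simp add: max.commute)
  have "3 \<le> s N" using s_mid[of N] N by auto
  moreover have "h N 1 + h N 2 - h N 3 = Max (y ` {1..N})" unfolding Mx l' by auto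
  ultimately show ?case using base by (auto simp: max_weight_def sparse_sum)
next
  case (step k)
  have s2: "2 \<le> s (Suc k)" using s_tail[of "Suc k"] step.hyps step.prems by auto
  have bnd: "2 \<le> k" "Suc k < l" "k < l" "1 \<in> {1..s (Suc k)}" "2 \<in> {1..s (Suc k)}"
    using s2 N(1) step.hyps step.prems by auto
  \<comment> \<open>By the induction hypothesis, the preactivations are plus and minus the maximum;
    ReLU makes them its positive and negative part.\<close>
  have "h (Suc k) 1 = max (Max (y ` {1..N})) 0" "h (Suc k) 2 = max (- Max (y ` {1..N})) 0"
    using assms(1)[OF bnd(1,2,4)] step.IH[OF bnd(3), of 1] assms(1)[OF bnd(1,2,5)] step.IH[OF bnd(3), of 2]
    by (simp_all del: One_nat_def)
  moreover note s2
  moreover have "i = 1 \<or> i = 2" using step.prems by auto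
  ultimately show ?case using \<open>N \<le> k\<close> by (elim disjE) (simp_all add: max_weight_def sparse_sum)
qed

text \<open>Pairs the two halves of a block of the first layer: neuron \<open>t\<close> with its
  mirror image \<open>d + t\<close>.\<close>

lemma sum_lessThan_double:
  fixes f :: "nat \<Rightarrow> 'a::comm_monoid_add"
  shows "(\<Sum>t<2 * d. f t) = (\<Sum>t<d. f t + f (d + t))"
proof -
  have "(\<Sum>t<d + n. f t) = (\<Sum>t<d. f t) + (\<Sum>t<n. f (d + t))" for n
    by (induction n) (simp_all add: add.assoc)
  from this[of d] show ?thesis by (simp add: sum.distrib mult_2)
qed

text \<open>The first layer holds, for every \<open>k\<close>, the positive and negative parts of \<open>x i - a k i\<close> in a
  block of \<open>2 d\<close> consecutive neurons. The factor \<open>2\<close> in the bound on \<open>c\<close> makes the bias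
  \<open>c 1 - c 2\<close> of the second layer admissible.\<close>

lemma exists_max_net:
  fixes a :: "nat \<Rightarrow> nat \<Rightarrow> real" and c :: "nat \<Rightarrow> real"
  assumes N: "2 \<le> N" "N < l" and d: "1 \<le> d"
    and ll_0: "ll 0 = d" and ll_1: "ll 1 \<ge> 2 * d * N"
    and ll_mid: "\<And>i. i \<in> {2..N} \<Longrightarrow> int (ll i) \<ge> 2 * int N - 2 * int i + 3"
    and ll_tail: "\<And>j. j \<in> {N..<l} \<Longrightarrow> ll j \<ge> 2"
    and ll_l: "ll l = 1"
    and dd: "param_count ll l \<le> dd"
    and R: "1 \<le> R" "\<bar>L\<bar> \<le> R"
    and a: "\<And>k i. k \<in> {1..N} \<Longrightarrow> i \<in> {1..d} \<Longrightarrow> \<bar>a k i\<bar> \<le> R"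
    and c: "\<And>k. k \<in> {1..N} \<Longrightarrow> 2 * \<bar>c k\<bar> \<le> R"
  obtains \<theta> where "\<theta> \<in> PiE {1..dd} (\<lambda>_. {-R..R})"
    "\<And>x. clipped_net \<theta> ll l u v x 1 =
       max u (min (Max ((\<lambda>k. c k - L * (\<Sum>i=1..d. \<bar>x i - a k i\<bar>)) ` {1..N})) v)"
proof -
  \<comment> \<open>The weights with which the second layer turns the \<open>k\<close>-th block of
    the first layer into \<open>- L\<close> times the distance of \<open>x\<close> to
    \<open>a k\<close>.\<close>
  define Y where "Y k j = (if j \<le> 2 * d * N \<and> (j - 1) div (2 * d) + 1 = k then - L else 0)" for k j
  \<comment> \<open>In the second layer, neuron \<open>i > 1\<close> belongs to the index
    \<open>i div 2 + 1\<close>, even \<open>i\<close> carrying the positive part. This agrees with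
    the positions \<open>2 * (k - 2) + 2\<close> and \<open>2 * (k - 2) + 3\<close> that
    \<open>max_layers\<close> starts from.\<close>
  define W where "W k i j = (if k = 1 then
      let t = (i - 1) mod (2 * d) in if t < d then pick (t + 1) j else - pick (t - d + 1) j
    else if k = 2 then
      if i = 1 then Y 1 j - Y 2 j else if even i then Y (i div 2 + 1) j else - Y (i div 2 + 1) j
    else max_weight N k i j)" for k i j
  \<comment> \<open>The guards keep the first index of \<open>a\<close> and the index of
    \<open>c\<close> within \<open>{1..N}\<close>, where the bounds are available; surplus neurons
    get bias 0.\<close>
  define b where "b k i = (if k = 1 then
      let t = (i - 1) mod (2 * d); q = (i - 1) div (2 * d) in
      if i \<le> 2 * d * N then if t < d then - a (q + 1) (t + 1) else a (q + 1) (t - d + 1) else 0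
    else if k = 2 then
      if i = 1 then c 1 - c 2 else if i div 2 + 1 \<le> N then
        if even i then c (i div 2 + 1) else - c (i div 2 + 1) else 0
    else 0)" for k i :: nat
  have W_le: "\<bar>W k i j\<bar> \<le> R" for k i j
  proof -
    have "\<bar>Y k j\<bar> \<le> R" "\<bar>Y 1 j - Y 2 j\<bar> \<le> R" "\<bar>pick k j\<bar> \<le> R" for k j
      using R by (auto simp: Y_def pick_def)
    moreover have "\<bar>max_weight N k i j\<bar> \<le> R" using abs_max_weight_le[of N k i j] R by linarith
    ultimately show ?thesis unfolding W_def Let_def by (simp split: if_split)
  qed
  have b_le: "\<bar>b k i\<bar> \<le> R" for k i
  proof -
    have c': "\<bar>c k\<bar> \<le> R" if "k \<in> {1..N}" for k using c[OF that] by linarith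
    have "2 * \<bar>c 1\<bar> \<le> R" "2 * \<bar>c 2\<bar> \<le> R" using c N by auto
    then have c12: "\<bar>c 1 - c 2\<bar> \<le> R" by linarith
    have a': "\<bar>a ((i - 1) div (2 * d) + 1) m\<bar> \<le> R" if "i \<le> 2 * d * N" "m \<in> {1..d}" for m
    proof -
      have "i - 1 < N * (2 * d)" using that N d by (cases i) (auto simp: mult_ac)
      then have "(i - 1) div (2 * d) < N" by (simp add: less_mult_imp_div_less)
      then show ?thesis using a that by simp
    qed
    have t: "(i - 1) mod (2 * d) < 2 * d" using d by simp
    have c_i: "\<bar>c (i div 2 + 1)\<bar> \<le> R" if "i div 2 + 1 \<le> N" using c' that by simp
    have a1: "\<bar>a ((i - 1) div (2 * d) + 1) ((i - 1) mod (2 * d) + 1)\<bar> \<le> R"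
      if "i \<le> 2 * d * N" "(i - 1) mod (2 * d) < d" by (rule a') (use that in auto)
    have a2: "\<bar>a ((i - 1) div (2 * d) + 1) ((i - 1) mod (2 * d) - d + 1)\<bar> \<le> R"
      if "i \<le> 2 * d * N"
    proof (rule a'[OF that])
      have "m - d + 1 \<in> {1..d}" if "m < 2 * d" for m using that d by auto
      from this[OF t] show "(i - 1) mod (2 * d) - d + 1 \<in> {1..d}" .
    qed
    have if_le: "\<bar>if B then x else y\<bar> \<le> R" if "B \<Longrightarrow> \<bar>x\<bar> \<le> R" "\<not> B \<Longrightarrow> \<bar>y\<bar> \<le> R" for B x y
      using that by simp
    show ?thesis unfolding b_def Let_def using R
      by (intro if_le; simp only: abs_minus_cancel abs_zero a1 a2 c_i c12)
  qed
  obtain \<theta> where \<theta>: "\<theta> \<in> PiE {1..dd} (\<lambda>_. {-R..R})"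
    "\<And>k x. k < l \<Longrightarrow> affine_map \<theta> (param_count ll k) (ll (Suc k)) (ll k) x =
        restrict (\<lambda>i. (\<Sum>j=1..ll k. W (Suc k) i j * x j) + b (Suc k) i) {1..ll (Suc k)}"
    using exists_parameters[of W R b ll l dd, OF W_le b_le dd] by blast
  show ?thesis
  proof (rule that[OF \<theta>(1)])
    fix x :: "nat \<Rightarrow> real"
    define y where "y k = c k - L * (\<Sum>i=1..d. \<bar>x i - a k i\<bar>)" for k
    define h where "h k = hidden_layers \<theta> ll k x" for k
    have h: "h (Suc k) i = max ((\<Sum>j=1..ll k. W (Suc k) i j * h k j) + b (Suc k) i) 0"
      if "k < l" "i \<in> {1..ll (Suc k)}" for k i
      using that by (simp add: h_def relu_vec_def \<theta>(2))
    have h1: "h 1 i = max ((\<Sum>j=1..d. W 1 i j * x j) + b 1 i) 0" if "i \<in> {1..ll 1}" for i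
      using h[of 0 i] that N by (simp add: h_def ll_0)
    \<comment> \<open>The two neurons hold the positive parts of \<open>z\<close> and of
      \<open>- z\<close> for one coordinate difference \<open>z\<close>, and these add up to its
      modulus.\<close>
    have block: "h 1 ((k - 1) * (2 * d) + t + 1) + h 1 ((k - 1) * (2 * d) + (d + t) + 1) = \<bar>x (t + 1) - a k (t + 1)\<bar>"
      if k: "k \<in> {1..N}" and t: "t < d" for k t
    proof -
      have le: "(k - 1) * (2 * d) + s + 1 \<le> 2 * d * N" if "s < 2 * d" for s
      proof -
        have "(k - 1) * (2 * d) + s + 1 \<le> (k - 1) * (2 * d) + 2 * d" using that by simp
        also have "\<dots> = k * (2 * d)" using k by (cases k) auto
        also have "\<dots> \<le> N * (2 * d)" using k by (intro mult_right_mono) auto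
        finally show ?thesis by (simp add: mult_ac)
      qed
      have dm: "((k - 1) * (2 * d) + s + 1 - 1) mod (2 * d) = s" "((k - 1) * (2 * d) + s + 1 - 1) div (2 * d) = k - 1"
        if "s < 2 * d" for s using that by simp_all
      have t2: "t < 2 * d" "d + t < 2 * d" using t by auto
      have k': "k - 1 + 1 = k" using k by simp
      have "h 1 ((k - 1) * (2 * d) + t + 1) = max (x (t + 1) - a k (t + 1)) 0"
        using le[OF t2(1)] ll_1 t k'
        by (subst h1) (auto simp: W_def b_def Let_def dm[OF t2(1)] sum_pick simp del: One_nat_def)
      moreover have "h 1 ((k - 1) * (2 * d) + (d + t) + 1) = max (a k (t + 1) - x (t + 1)) 0"
        using le[OF t2(2)] ll_1 t k'
        by (subst h1) (auto simp: W_def b_def Let_def dm[OF t2(2)] sum_pick sum_negf simp del: One_nat_def)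
      ultimately show ?thesis by auto
    qed
    have Y_sum: "(\<Sum>j=1..ll 1. Y k j * h 1 j) + c k = y k" if k: "k \<in> {1..N}" for k
    proof -
      \<comment> \<open>\<open>?g\<close> enumerates the \<open>k\<close>-th block;
        \<open>Y k\<close> is \<open>- L\<close> on it and 0 on the rest of the layer.\<close>
      let ?g = "\<lambda>t. (k - 1) * (2 * d) + t + 1"
      have inj: "inj_on ?g {..<2 * d}" by (auto simp: inj_on_def)
      have sub: "?g ` {..<2 * d} \<subseteq> {1..ll 1}"
      proof safe
        fix t assume "t < 2 * d"
        then have "(k - 1) * (2 * d) + t + 1 \<le> (k - 1) * (2 * d) + 2 * d" by simp
        also have "\<dots> = k * (2 * d)" using k by (cases k) auto
        also have "\<dots> \<le> N * (2 * d)" using k by (intro mult_right_mono) auto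
        finally show "?g t \<in> {1..ll 1}" using ll_1 by (simp add: mult_ac)
      qed
      have Yg: "Y k j = - L" if j: "j \<in> ?g ` {..<2 * d}" for j
      proof -
        obtain t where t: "t < 2 * d" "j = ?g t" using j by blast
        have "j \<le> (k - 1) * (2 * d) + 2 * d" using t by simp
        also have "\<dots> = k * (2 * d)" using k by (cases k) auto
        also have "\<dots> \<le> N * (2 * d)" using k by (intro mult_right_mono) auto
        finally have "j \<le> 2 * d * N" by (simp add: mult_ac)
        moreover have "(j - 1) div (2 * d) = k - 1" using t by simp
        ultimately show ?thesis using k by (simp add: Y_def)
      qed
      have Yz: "Y k j = 0" if "j \<in> {1..ll 1} - ?g ` {..<2 * d}" for j
      proof (rule ccontr)
        assume "Y k j \<noteq> 0"
        then have *: "(j - 1) div (2 * d) + 1 = k" by (auto simp: Y_def split: if_splits)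
        then have "(j - 1) div (2 * d) = k - 1" by simp
        then have "j = ?g ((j - 1) mod (2 * d))" using that
          by (metis One_nat_def Suc_eq_plus1 Suc_pred div_mult_mod_eq Diff_iff atLeastAtMost_iff less_eq_Suc_le)
        moreover have "(j - 1) mod (2 * d) < 2 * d" using d by simp
        ultimately show False using that by blast
      qed
      have "(\<Sum>j=1..ll 1. Y k j * h 1 j) = (\<Sum>j\<in>?g ` {..<2 * d}. Y k j * h 1 j)"
        by (rule sum.mono_neutral_right) (use sub Yz in auto)
      also have "\<dots> = (\<Sum>j\<in>?g ` {..<2 * d}. - L * h 1 j)" by (intro sum.cong refl) (simp only: Yg)
      also have "\<dots> = - L * (\<Sum>t<2 * d. h 1 (?g t))" by (simp only: sum.reindex[OF inj] o_def sum_distrib_left)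
      also have "(\<Sum>t<2 * d. h 1 (?g t)) = (\<Sum>t<d. \<bar>x (t + 1) - a k (t + 1)\<bar>)"
        unfolding sum_lessThan_double by (intro sum.cong refl block[OF k]) auto
      also have "\<dots> = (\<Sum>i=1..d. \<bar>x i - a k i\<bar>)"
        by (rule sum.reindex_bij_witness[of _ "\<lambda>i. i - 1" "\<lambda>t. t + 1"]) auto
      finally show ?thesis by (simp add: y_def)
    qed
    have s2: "2 * (N - 2) + 3 \<le> ll 2" using ll_mid[of 2] N by auto
    have base1: "h 2 1 = max (y 1 - y 2) 0"
    proof -
      have l1: "1 < l" using N by simp
      have i: "1 \<in> {1..ll (Suc 1)}" using s2 unfolding Suc_1 by simp
      have "W (Suc 1) 1 j = Y 1 j - Y 2 j" "b (Suc 1) 1 = c 1 - c 2" for j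
        by (simp_all add: W_def b_def)
      then have "h 2 1 = max ((\<Sum>j=1..ll 1. (Y 1 j - Y 2 j) * h 1 j) + (c 1 - c 2)) 0"
        using h[OF l1 i] by (simp only: Suc_1)
      also have "(\<Sum>j=1..ll 1. (Y 1 j - Y 2 j) * h 1 j) + (c 1 - c 2) = y 1 - y 2"
        using Y_sum[of 1] Y_sum[of 2] N by (simp add: left_diff_distrib sum_subtractf)
      finally show ?thesis .
    qed
    have base2: "h 2 (2 * (k - 2) + 2) = max (y k) 0 \<and> h 2 (2 * (k - 2) + 3) = max (- y k) 0"
      if k: "k \<in> {2..N}" for k
    proof -
      obtain e where e: "k = e + 2" using k by (metis atLeastAtMost_iff le_add_diff_inverse2)
      have ke: "k \<in> {1..N}" using k by auto
      have i: "2 * e + 2 \<in> {1..ll (Suc 1)}" "2 * e + 3 \<in> {1..ll (Suc 1)}"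
        using s2 k unfolding Suc_1 by (simp_all add: e)
      have W2: "W (Suc 1) (2 * e + 2) j = Y k j" "W (Suc 1) (2 * e + 3) j = - Y k j" for j
        by (auto simp: W_def e)
      have b2: "b (Suc 1) (2 * e + 2) = c k" "b (Suc 1) (2 * e + 3) = - c k"
        using k by (auto simp: b_def e)
      have l1: "1 < l" using N by simp
      have "h (Suc 1) (2 * e + 2) = max (y k) 0"
        unfolding h[OF l1 i(1)] W2 b2 Y_sum[OF ke] ..
      moreover have "h (Suc 1) (2 * e + 3) = max (- y k) 0"
        unfolding h[OF l1 i(2)] W2 b2 using Y_sum[OF ke] by (simp add: sum_negf)
      ultimately show ?thesis unfolding Suc_1 e by simp
    qed
    have step: "h (Suc k) i = max (\<Sum>j=1..ll k. max_weight N (Suc k) i j * h k j) 0"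
      if "2 \<le> k" "Suc k < l" "i \<in> {1..ll (Suc k)}" for k i
      using h[of k i] that by (simp add: W_def b_def)
    obtain m where m: "l = Suc m" using N by (cases l) auto
    have "(\<Sum>j=1..ll m. max_weight N (Suc m) 1 j * h m j) = Max (y ` {1..N})"
      using max_output[of l ll h N y m 1, OF step ll_mid ll_tail base1 base2] N m by auto
    \<comment> \<open>Since \<open>l\<close> is at least 3, the output layer falls under the
      \<open>max_weight\<close> case of \<open>W\<close>, with bias 0.\<close>
    moreover have "clipped_net \<theta> ll l u v x 1 = max u (min (\<Sum>j=1..ll m. max_weight N (Suc m) 1 j * h m j) v)"
      using N \<theta>(2)[of m] ll_l by (simp add: clipped_net_def clip_vec_def h_def W_def b_def m)
    ultimately show "clipped_net \<theta> ll l u v x 1 =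
       max u (min (Max ((\<lambda>k. c k - L * (\<Sum>i=1..d. \<bar>x i - a k i\<bar>)) ` {1..N})) v)"
      by (simp add: y_def)
  qed
qed

section \<open>Approximation of Lipschitz functions\<close>

text \<open>The infimum is attained because \<open>enat\<close> is well-ordered, and the finite
  bound \<open>n\<close> excludes the value infinity.\<close>

lemma covering_number_leE:
  assumes "covering_number E \<delta> r \<le> enat n"
  obtains A where "A \<subseteq> E" "finite A" "card A \<le> n" "\<And>x. x \<in> E \<Longrightarrow> \<exists>a\<in>A. ereal (\<delta> a x) \<le> r"
proof -
  let ?S = "{enat n | n. \<exists>A. A \<subseteq> E \<and> finite A \<and> card A \<le> n \<and> (\<forall>x\<in>E. \<exists>a\<in>A. ereal (\<delta> a x) \<le> r)} \<union> {\<infinity>}"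
  have "Inf ?S \<in> ?S" by (rule wellorder_InfI[of \<infinity>]) simp
  then obtain m A where "enat m = covering_number E \<delta> r" "A \<subseteq> E" "finite A" "card A \<le> m"
      "\<forall>x\<in>E. \<exists>a\<in>A. ereal (\<delta> a x) \<le> r"
    using assms unfolding covering_number_def by fastforce
  then show ?thesis using that[of A] assms by (metis enat_ord_simps(1) order.trans)
qed

text \<open>By the Lipschitz condition, each \<open>\<phi> (a k) - L * \<delta> x (a k)\<close> lies
  below \<open>\<phi> x\<close>, and for a centre near \<open>x\<close> it falls short by at most
  twice \<open>\<epsilon> / 4\<close>. Clipping does not increase the error, as
  \<open>\<phi>\<close> takes values in \<open>{u..v}\<close>.\<close>

lemma lipschitz_approximation:
  fixes \<phi> :: "(nat \<Rightarrow> real) \<Rightarrow> real" and D :: "(nat \<Rightarrow> real) set"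
    and d N l :: nat
  defines "\<delta> \<equiv> \<lambda>x y. \<Sum>i=1..d. \<bar>x i - y i\<bar>"
  assumes N: "2 \<le> N" "N < l" and d: "1 \<le> d"
    and ll_0: "ll 0 = d" and ll_1: "ll 1 \<ge> 2 * d * N"
    and ll_mid: "\<And>i. i \<in> {2..N} \<Longrightarrow> int (ll i) \<ge> 2 * int N - 2 * int i + 3"
    and ll_tail: "\<And>j. j \<in> {N..<l} \<Longrightarrow> ll j \<ge> 2"
    and ll_l: "ll l = 1"
    and dd: "param_count ll l \<le> dd"
    and R: "1 \<le> R" "L \<le> R" and L: "0 \<le> L"
    and D: "D \<noteq> {}" "\<And>x i. x \<in> D \<Longrightarrow> i \<in> {1..d} \<Longrightarrow> \<bar>x i\<bar> \<le> R"
    and \<phi>: "\<And>x. x \<in> D \<Longrightarrow> 2 * \<bar>\<phi> x\<bar> \<le> R" "\<And>x. x \<in> D \<Longrightarrow> \<phi> x \<in> {u..v}"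
    and lip: "\<And>x y. x \<in> D \<Longrightarrow> y \<in> D \<Longrightarrow> \<bar>\<phi> x - \<phi> y\<bar> \<le> L * \<delta> x y"
    and \<epsilon>: "0 < \<epsilon>" and cover: "covering_number D \<delta> (ereal \<epsilon> / ereal (4 * L)) \<le> enat N"
  obtains \<theta> where "\<theta> \<in> PiE {1..dd} (\<lambda>_. {-R..R})"
    "\<And>x. x \<in> D \<Longrightarrow> \<bar>clipped_net \<theta> ll l u v x 1 - \<phi> x\<bar> \<le> \<epsilon> / 2"
proof -
  obtain A where A: "A \<subseteq> D" "finite A" "card A \<le> N"
    and A_cover: "\<And>x. x \<in> D \<Longrightarrow> \<exists>a\<in>A. ereal (\<delta> a x) \<le> ereal \<epsilon> / ereal (4 * L)"
    using covering_number_leE[OF cover] by blast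
  have near: "\<exists>a\<in>A. L * \<delta> x a \<le> \<epsilon> / 4" if x: "x \<in> D" for x
  proof -
    obtain a where a: "a \<in> A" "ereal (\<delta> a x) \<le> ereal \<epsilon> / ereal (4 * L)" using A_cover[OF x] by blast
    have sym: "\<delta> x a = \<delta> a x" by (simp add: \<delta>_def abs_minus_commute)
    have "L * \<delta> x a \<le> \<epsilon> / 4"
    \<comment> \<open>For \<open>L = 0\<close> the radius \<open>\<epsilon> / (4 * L)\<close> is
      infinite in \<open>ereal\<close> and gives no information on the distance, but then the
      product vanishes.\<close>
    proof (cases "L = 0")
      case False
      then have "\<delta> a x \<le> \<epsilon> / (4 * L)" using a by simp
      then show ?thesis using L False unfolding sym by (simp add: field_simps)
    qed (use \<epsilon> in simp)
    then show ?thesis using a by blast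
  qed
  have "A \<noteq> {}" using D near by blast
  then have "card A \<noteq> 0" using A by simp
  obtain e where e: "bij_betw e {1..card A} A"
    using ex_bij_betw_nat_finite_1[OF A(2)] by blast
  \<comment> \<open>The cover may have fewer than \<open>N\<close> points; repeating its first
    centre pads the list without changing the maximum.\<close>
  define a where "a k = (if k \<le> card A then e k else e 1)" for k
  have a_im: "a ` {1..N} = A"
  proof -
    have "e ` {1..card A} = A" using e by (simp add: bij_betw_def)
    moreover have "a ` {1..N} = e ` {1..card A}"
    proof (intro equalityI subsetI)
      fix y assume "y \<in> a ` {1..N}"
      then show "y \<in> e ` {1..card A}" using \<open>card A \<noteq> 0\<close> by (auto simp: a_def)
    next
      fix y assume "y \<in> e ` {1..card A}"
      then obtain k where k: "k \<in> {1..card A}" "y = e k" by blast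
      then show "y \<in> a ` {1..N}" using A(3) by (intro image_eqI[of _ _ k]) (auto simp: a_def)
    qed
    ultimately show ?thesis by simp
  qed
  have aD: "a k \<in> D" if "k \<in> {1..N}" for k using a_im that A by blast
  have L_le: "\<bar>L\<bar> \<le> R" using L R by simp
  obtain \<theta> where \<theta>: "\<theta> \<in> PiE {1..dd} (\<lambda>_. {-R..R})"
    "\<And>x. clipped_net \<theta> ll l u v x 1 =
       max u (min (Max ((\<lambda>k. \<phi> (a k) - L * (\<Sum>i=1..d. \<bar>x i - a k i\<bar>)) ` {1..N})) v)"
    using exists_max_net[of N l d ll dd R L a "\<lambda>k. \<phi> (a k)" u v,
        OF N d ll_0 ll_1 ll_mid ll_tail ll_l dd R(1) L_le D(2)[OF aD] \<phi>(1)[OF aD]]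
    by blast
  show ?thesis
  proof (rule that[OF \<theta>(1)])
    fix x assume x: "x \<in> D"
    define m where "m = Max ((\<lambda>k. \<phi> (a k) - L * \<delta> x (a k)) ` {1..N})"
    have "m \<le> \<phi> x"
    proof -
      have "\<phi> (a k) - L * \<delta> x (a k) \<le> \<phi> x" if "k \<in> {1..N}" for k
        using lip[OF x aD[OF that]] by linarith
      moreover have "{1..N} \<noteq> {}" using N by auto
      ultimately show ?thesis unfolding m_def by simp
    qed
    \<comment> \<open>The distance to the chosen centre is paid twice: in passing from
      \<open>\<phi> x\<close> to \<open>\<phi> (a k)\<close> and in the penalty term.\<close>
    moreover have "\<phi> x - \<epsilon> / 2 \<le> m"
    proof -
      obtain b where b: "b \<in> A" "L * \<delta> x b \<le> \<epsilon> / 4" using near[OF x] by blast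
      then obtain k where k: "k \<in> {1..N}" "b = a k" using a_im by blast
      have "\<phi> (a k) - L * \<delta> x (a k) \<le> m" unfolding m_def using k by (intro Max_ge) auto
      moreover have "\<phi> x - \<phi> (a k) \<le> L * \<delta> x (a k)" using lip[OF x aD[OF k(1)]] by linarith
      ultimately show ?thesis using b k by simp
    qed
    moreover have "clipped_net \<theta> ll l u v x 1 = max u (min m v)" using \<theta>(2)[of x] by (simp add: m_def \<delta>_def)
    ultimately show "\<bar>clipped_net \<theta> ll l u v x 1 - \<phi> x\<bar> \<le> \<epsilon> / 2"
      using \<phi>(2)[OF x] \<epsilon> by (auto simp: max_def min_def abs_le_iff)
  qed
qed

section \<open>Dependence of the network on its parameters\<close>

text \<open>Splits each product difference as \<open>(\<theta> - \<eta>) x + \<eta> (x - y)\<close>,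
  so that a change of parameters is weighted by the input size \<open>H\<close> and a change of
  input by the parameter size \<open>R\<close>. The common width bound \<open>w\<close> keeps the
  constants independent of the layer.\<close>

lemma affine_map_bound_lipschitz:
  fixes R \<rho> H \<Delta> :: real and w :: nat
  assumes \<theta>: "\<And>p. p \<in> {1..dd} \<Longrightarrow> \<bar>\<theta> p\<bar> \<le> R" and \<eta>: "\<And>p. p \<in> {1..dd} \<Longrightarrow> \<bar>\<eta> p\<bar> \<le> R"
    and close: "\<And>p. p \<in> {1..dd} \<Longrightarrow> \<bar>\<theta> p - \<eta> p\<bar> \<le> \<rho>"
    and x: "\<And>j. j \<in> {1..s} \<Longrightarrow> \<bar>x j\<bar> \<le> H" and xy: "\<And>j. j \<in> {1..s} \<Longrightarrow> \<bar>x j - y j\<bar> \<le> \<Delta>"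
    and nonneg: "0 \<le> R" "0 \<le> \<rho>" "0 \<le> H" "0 \<le> \<Delta>"
    and w: "s \<le> w" and dd: "k + r * (s + 1) \<le> dd" and i: "i \<in> {1..r}"
  shows "\<bar>affine_map \<theta> k r s x i\<bar> \<le> R * (real w * H + 1)"
    and "\<bar>affine_map \<theta> k r s x i - affine_map \<eta> k r s y i\<bar> \<le> \<rho> * (real w * H + 1) + R * real w * \<Delta>"
proof -
  define p where "p j = k + (i - 1) * s + j" for j
  define q where "q = k + r * s + i"
  have p: "p j \<in> {1..dd}" if "j \<in> {1..s}" for j
  proof -
    have "(i - 1) * s + j \<le> (i - 1) * s + s" using that by simp
    also have "\<dots> = i * s" using i by (cases i) auto
    also have "\<dots> \<le> r * s" using i by simp
    finally show ?thesis using that dd by (simp add: p_def)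
  qed
  have q: "q \<in> {1..dd}" using i dd by (simp add: q_def)
  have sw: "real s * H \<le> real w * H" "real s * \<Delta> \<le> real w * \<Delta>"
    using w nonneg by (simp_all add: mult_right_mono)
  have aff: "affine_map \<theta>' k r s z i = (\<Sum>j=1..s. \<theta>' (p j) * z j) + \<theta>' q" for \<theta>' z
    using i by (simp add: affine_map_def p_def q_def)
  have "\<bar>\<Sum>j=1..s. \<theta> (p j) * x j\<bar> \<le> (\<Sum>j=1..s. R * H)"
  proof (rule order.trans[OF sum_abs sum_mono])
    fix j assume j: "j \<in> {1..s}"
    show "\<bar>\<theta> (p j) * x j\<bar> \<le> R * H"
      unfolding abs_mult by (intro mult_mono \<theta> x p j) (use nonneg in auto)
  qed
  also have "\<dots> \<le> R * (real w * H)" using mult_left_mono[OF sw(1) nonneg(1)] by (simp add: mult_ac)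
  finally show "\<bar>affine_map \<theta> k r s x i\<bar> \<le> R * (real w * H + 1)"
    unfolding aff using \<theta>[OF q] by (simp add: distrib_left)
  have "\<bar>\<Sum>j=1..s. \<theta> (p j) * x j - \<eta> (p j) * y j\<bar> \<le> (\<Sum>j=1..s. \<rho> * H + R * \<Delta>)"
  proof (rule order.trans[OF sum_abs sum_mono])
    fix j assume j: "j \<in> {1..s}"
    have "\<bar>(\<theta> (p j) - \<eta> (p j)) * x j\<bar> \<le> \<rho> * H" "\<bar>\<eta> (p j) * (x j - y j)\<bar> \<le> R * \<Delta>"
      unfolding abs_mult by (intro mult_mono close \<eta> x xy p j; use nonneg in auto)+
    then show "\<bar>\<theta> (p j) * x j - \<eta> (p j) * y j\<bar> \<le> \<rho> * H + R * \<Delta>"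
      by (simp add: algebra_simps)
  qed
  also have "\<dots> \<le> \<rho> * (real w * H) + R * (real w * \<Delta>)"
    using mult_left_mono[OF sw(1) nonneg(2)] mult_left_mono[OF sw(2) nonneg(1)] by (simp add: algebra_simps)
  finally show "\<bar>affine_map \<theta> k r s x i - affine_map \<eta> k r s y i\<bar> \<le> \<rho> * (real w * H + 1) + R * real w * \<Delta>"
    unfolding aff using close[OF q] by (simp add: sum_subtractf algebra_simps)
qed

text \<open>Size and perturbation are propagated together, since the perturbation in a layer depends
  on the size of its input. Each layer multiplies both by at most \<open>R * (real w + 1)\<close>
  and adds one perturbation term of the same order, whence the linear factor
  \<open>k + 1\<close>.\<close>

lemma preactivation_bound_lipschitz:
  fixes R \<rho> :: real and w :: nat
  assumes R: "1 \<le> R" and \<rho>: "0 \<le> \<rho>"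
    and \<theta>: "\<And>p. p \<in> {1..dd} \<Longrightarrow> \<bar>\<theta> p\<bar> \<le> R" and \<eta>: "\<And>p. p \<in> {1..dd} \<Longrightarrow> \<bar>\<eta> p\<bar> \<le> R"
    and close: "\<And>p. p \<in> {1..dd} \<Longrightarrow> \<bar>\<theta> p - \<eta> p\<bar> \<le> \<rho>"
    and x: "\<And>i. i \<in> {1..ll 0} \<Longrightarrow> \<bar>x i\<bar> \<le> R"
    and w: "\<And>i. i \<le> k \<Longrightarrow> ll i \<le> w" and dd: "param_count ll (Suc k) \<le> dd"
    and i: "i \<in> {1..ll (Suc k)}"
  defines "A \<equiv> \<lambda>\<theta> k. affine_map \<theta> (param_count ll k) (ll (Suc k)) (ll k) (hidden_layers \<theta> ll k x)"
  shows "\<bar>A \<theta> k i\<bar> \<le> R ^ (k + 2) * (real w + 1) ^ (k + 1)"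
    and "\<bar>A \<theta> k i - A \<eta> k i\<bar> \<le> real (k + 1) * (real w + 1) ^ (k + 1) * R ^ (k + 1) * \<rho>"
proof -
  have "\<bar>A \<theta> k i\<bar> \<le> R ^ (k + 2) * (real w + 1) ^ (k + 1) \<and>
    \<bar>A \<theta> k i - A \<eta> k i\<bar> \<le> real (k + 1) * (real w + 1) ^ (k + 1) * R ^ (k + 1) * \<rho>"
    using w dd i
  proof (induction k arbitrary: i)
    have R0: "0 \<le> R" using R by simp
    let ?v = "real w + 1"
    \<comment> \<open>One layer for arbitrary \<open>k\<close>, given bounds on its input. It serves
      the base case, where the inputs coincide, as well as the induction step, where they come from
      the previous layer.\<close>
    have layer: "\<bar>A \<theta> k i\<bar> \<le> R ^ (k + 2) * ?v ^ (k + 1) \<and>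
        \<bar>A \<theta> k i - A \<eta> k i\<bar> \<le> real (k + 1) * ?v ^ (k + 1) * R ^ (k + 1) * \<rho>"
      if "i \<in> {1..ll (Suc k)}" "param_count ll (Suc k) \<le> dd" "ll k \<le> w"
        and hyp: "\<And>j. j \<in> {1..ll k} \<Longrightarrow> \<bar>hidden_layers \<theta> ll k x j\<bar> \<le> R ^ (k + 1) * ?v ^ k"
        "\<And>j. j \<in> {1..ll k} \<Longrightarrow> \<bar>hidden_layers \<theta> ll k x j - hidden_layers \<eta> ll k x j\<bar> \<le> real k * ?v ^ k * R ^ k * \<rho>"
      for k i
    proof -
      define H where "H = R ^ (k + 1) * ?v ^ k"
      define \<Delta> where "\<Delta> = real k * ?v ^ k * R ^ k * \<rho>"
      have H1: "1 \<le> H" unfolding H_def using R by (simp add: mult_ge1_I one_le_power)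
      have \<Delta>0: "0 \<le> \<Delta>" unfolding \<Delta>_def using R0 \<rho> by simp
      have pc: "param_count ll k + ll (Suc k) * (ll k + 1) \<le> dd" using that by simp
      note aff = affine_map_bound_lipschitz[of dd \<theta> R \<eta> \<rho> "ll k" "hidden_layers \<theta> ll k x" H
          "hidden_layers \<eta> ll k x" \<Delta>, OF \<theta> \<eta> close hyp[folded H_def \<Delta>_def] R0 \<rho> _ \<Delta>0 \<open>ll k \<le> w\<close> pc \<open>i \<in> _\<close>]
      \<comment> \<open>As \<open>H\<close> is at least 1, the contribution of the bias counts as
        that of one further input.\<close>
      have wH: "real w * H + 1 \<le> ?v * H" using H1 by (simp add: algebra_simps)
      have "\<bar>A \<theta> k i\<bar> \<le> R * (real w * H + 1)" unfolding A_def using H1 by (intro aff) auto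
      also have "\<dots> \<le> R * (?v * H)" by (intro mult_left_mono wH R0)
      also have "\<dots> = R ^ (k + 2) * ?v ^ (k + 1)" by (simp add: H_def mult_ac)
      finally have 1: "\<bar>A \<theta> k i\<bar> \<le> R ^ (k + 2) * ?v ^ (k + 1)" .
      have "\<bar>A \<theta> k i - A \<eta> k i\<bar> \<le> \<rho> * (real w * H + 1) + R * real w * \<Delta>" unfolding A_def using H1 by (intro aff) auto
      also have "\<dots> \<le> \<rho> * (?v * H) + R * ?v * \<Delta>"
        by (intro add_mono mult_left_mono mult_right_mono wH) (use R0 \<rho> \<Delta>0 in auto)
      also have "\<dots> = real (k + 1) * ?v ^ (k + 1) * R ^ (k + 1) * \<rho>"
        by (simp add: H_def \<Delta>_def algebra_simps)
      finally show ?thesis using 1 by blast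
    qed
    {
      case 0
      show ?case by (rule layer) (use 0 x in auto)
    next
      case (Suc k)
      have IH: "\<bar>A \<theta> k i\<bar> \<le> R ^ (k + 2) * ?v ^ (k + 1)"
        "\<bar>A \<theta> k i - A \<eta> k i\<bar> \<le> real (k + 1) * ?v ^ (k + 1) * R ^ (k + 1) * \<rho>"
        if "i \<in> {1..ll (Suc k)}" for i
        using Suc.IH[of i] Suc.prems param_count_mono[of "Suc k" "Suc (Suc k)" ll] that by auto
      have hid: "hidden_layers \<theta>' ll (Suc k) x j = max (A \<theta>' k j) 0" if "j \<in> {1..ll (Suc k)}" for \<theta>' j
        using that by (simp add: A_def relu_vec_def)
      show ?case
      proof (rule layer)
        fix j assume j: "j \<in> {1..ll (Suc k)}"
        show "\<bar>hidden_layers \<theta> ll (Suc k) x j\<bar> \<le> R ^ (Suc k + 1) * ?v ^ Suc k"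
          using IH(1)[OF j] unfolding hid[OF j] by auto
        have "\<bar>max (A \<theta> k j) 0 - max (A \<eta> k j) 0\<bar> \<le> \<bar>A \<theta> k j - A \<eta> k j\<bar>" by auto
        then show "\<bar>hidden_layers \<theta> ll (Suc k) x j - hidden_layers \<eta> ll (Suc k) x j\<bar>
            \<le> real (Suc k) * ?v ^ Suc k * R ^ Suc k * \<rho>"
          using IH(2)[OF j] unfolding hid[OF j] by simp
      qed (use Suc.prems in auto)
    }
  qed
  then show "\<bar>A \<theta> k i\<bar> \<le> R ^ (k + 2) * (real w + 1) ^ (k + 1)"
    "\<bar>A \<theta> k i - A \<eta> k i\<bar> \<le> real (k + 1) * (real w + 1) ^ (k + 1) * R ^ (k + 1) * \<rho>" by auto
qed

text \<open>Clipping is nonexpansive, so the estimate for the last preactivation,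
  \<open>k = l - 1\<close>, carries over. The factor in front of \<open>\<rho>\<close> is the
  constant \<open>\<Lambda>\<close>.\<close>

lemma clipped_net_lipschitz:
  fixes R \<rho> :: real and w :: nat
  assumes R: "1 \<le> R" and l: "1 \<le> l"
    and \<theta>: "\<theta> \<in> PiE {1..dd} (\<lambda>_. {-R..R})" and \<eta>: "\<eta> \<in> PiE {1..dd} (\<lambda>_. {-R..R})"
    and close: "\<And>p. p \<in> {1..dd} \<Longrightarrow> \<bar>\<theta> p - \<eta> p\<bar> \<le> \<rho>" and \<rho>: "0 \<le> \<rho>"
    and x: "\<And>i. i \<in> {1..ll 0} \<Longrightarrow> \<bar>x i\<bar> \<le> R"
    and w: "\<And>i. i \<le> l \<Longrightarrow> ll i \<le> w" and dd: "param_count ll l \<le> dd"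
    and i: "i \<in> {1..ll l}"
  shows "\<bar>clipped_net \<theta> ll l u v x i - clipped_net \<eta> ll l u v x i\<bar> \<le> real l * (real w + 1) ^ l * R ^ l * \<rho>"
proof -
  obtain k where k: "l = Suc k" using l by (cases l) auto
  define A where "A \<theta> = affine_map \<theta> (param_count ll k) (ll (Suc k)) (ll k) (hidden_layers \<theta> ll k x)" for \<theta>
  have mem: "\<bar>\<theta> p\<bar> \<le> R" if "p \<in> {1..dd}" "\<theta> \<in> PiE {1..dd} (\<lambda>_. {-R..R})" for p \<theta>
    using PiE_mem[OF that(2,1)] by (simp add: abs_le_iff)
  have "\<bar>A \<theta> i - A \<eta> i\<bar> \<le> real (k + 1) * (real w + 1) ^ (k + 1) * R ^ (k + 1) * \<rho>"
    unfolding A_def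
    by (rule preactivation_bound_lipschitz(2)[where dd = dd])
       (use assms k mem in auto)
  moreover have "\<bar>max u (min a v) - max u (min b v)\<bar> \<le> \<bar>a - b\<bar>" for a b :: real by (simp add: max_def min_def abs_if)
  ultimately have "\<bar>max u (min (A \<theta> i) v) - max u (min (A \<eta> i) v)\<bar>
      \<le> real (k + 1) * (real w + 1) ^ (k + 1) * R ^ (k + 1) * \<rho>"
    by (rule order.trans[rotated])
  then show ?thesis using i by (simp add: k A_def clipped_net_def clip_vec_def)
qed

section \<open>Range of the network and measurability in its input\<close>

lemma clipped_net_range: "u \<le> v \<Longrightarrow> i \<in> {1..ll l} \<Longrightarrow> clipped_net \<theta> ll l u v x i \<in> {u..v}"
  by (auto simp: clipped_net_def clip_vec_def)

lemma affine_map_measurable: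
  assumes "\<And>j. j \<in> {1..s} \<Longrightarrow> (\<lambda>x. f x j) \<in> borel_measurable M" and "i \<in> {1..r}"
  shows "(\<lambda>x. affine_map \<theta> k r s (f x) i) \<in> borel_measurable M"
  using assms by (simp add: affine_map_def)

lemma hidden_layers_measurable:
  assumes "\<And>j. j \<in> {1..ll 0} \<Longrightarrow> (\<lambda>x. f x j) \<in> borel_measurable M" and "i \<in> {1..ll k}"
  shows "(\<lambda>x. hidden_layers \<theta> ll k (f x) i) \<in> borel_measurable M"
  using assms(2)
proof (induction k arbitrary: i)
  case (Suc k)
  then show ?case by (auto simp: relu_vec_def intro!: borel_measurable_max affine_map_measurable)
qed (use assms in auto)

lemma clipped_net_measurable:
  assumes "\<And>j. j \<in> {1..ll 0} \<Longrightarrow> (\<lambda>x. f x j) \<in> borel_measurable M" and "i \<in> {1..ll l}"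
  shows "(\<lambda>x. clipped_net \<theta> ll l u v (f x) i) \<in> borel_measurable M"
  using assms unfolding clipped_net_def clip_vec_def
  by (auto intro!: borel_measurable_max borel_measurable_min affine_map_measurable hidden_layers_measurable)

section \<open>Empirical risk minimisation by random search\<close>

text \<open>Expand the square of \<open>(g - f) + (f - Y)\<close>. The cross term vanishes:
  \<open>g (X) - f (X)\<close> is measurable with respect to \<open>X\<close>, and
  \<open>f (X)\<close> is the conditional expectation of \<open>Y\<close>.\<close>

lemma (in prob_space) excess_risk_eq:
  fixes Y :: "'a \<Rightarrow> real" and f g :: "'b \<Rightarrow> real"
  assumes X [measurable]: "X \<in> measurable M S" and Y [measurable]: "Y \<in> borel_measurable M"
    and f [measurable]: "f \<in> borel_measurable S" and g [measurable]: "g \<in> borel_measurable S"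
    and bounded: "\<And>\<omega>. \<omega> \<in> space M \<Longrightarrow> \<bar>Y \<omega>\<bar> \<le> C \<and> \<bar>f (X \<omega>)\<bar> \<le> C \<and> \<bar>g (X \<omega>)\<bar> \<le> C"
    and condexp: "AE \<omega> in M. f (X \<omega>) = real_cond_exp M (vimage_algebra (space M) X S) Y \<omega>"
  shows "expectation (\<lambda>\<omega>. (g (X \<omega>) - f (X \<omega>))\<^sup>2) =
    expectation (\<lambda>\<omega>. (g (X \<omega>) - Y \<omega>)\<^sup>2) - expectation (\<lambda>\<omega>. (f (X \<omega>) - Y \<omega>)\<^sup>2)"
proof -
  let ?F = "vimage_algebra (space M) X S"
  have sub: "subalgebra M ?F"
    unfolding subalgebra_def using X by (simp add: measurable_iff_sets)
  interpret finite_measure_subalgebra M ?F by unfold_locales (fact sub)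
  have XF [measurable]: "X \<in> measurable ?F S"
    using X by (intro measurable_vimage_algebra1) (auto simp: measurable_def)
  define h where "h x = g x - f x" for x
  have h [measurable]: "h \<in> borel_measurable S" unfolding h_def by measurable
  have hF: "(\<lambda>\<omega>. h (X \<omega>)) \<in> borel_measurable ?F" by measurable
  have hb: "\<bar>h (X \<omega>)\<bar> \<le> 2 * C" if "\<omega> \<in> space M" for \<omega>
    unfolding h_def using bounded[OF that] by linarith
  have C0: "0 \<le> C" using bounded not_empty by (meson abs_ge_zero all_not_in_conv order.trans)
  \<comment> \<open>All factors occurring in the expansion are bounded by \<open>2 * C\<close>, so
    one criterion makes every product integrable.\<close>
  have prod_int: "integrable M (\<lambda>\<omega>. p \<omega> * q \<omega>)"
    if "p \<in> borel_measurable M" "q \<in> borel_measurable M"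
      and "\<And>\<omega>. \<omega> \<in> space M \<Longrightarrow> \<bar>p \<omega>\<bar> \<le> 2 * C" "\<And>\<omega>. \<omega> \<in> space M \<Longrightarrow> \<bar>q \<omega>\<bar> \<le> 2 * C" for p q :: "'a \<Rightarrow> real"
  proof (rule integrable_const_bound[where B = "2 * C * (2 * C)"])
    show "AE \<omega> in M. norm (p \<omega> * q \<omega>) \<le> 2 * C * (2 * C)"
      using that(3,4) C0 unfolding real_norm_def abs_mult by (intro AE_I2 mult_mono) auto
  qed (use that in measurable)
  have Yb: "\<bar>Y \<omega>\<bar> \<le> 2 * C" "\<bar>f (X \<omega>)\<bar> \<le> 2 * C" "\<bar>f (X \<omega>) - Y \<omega>\<bar> \<le> 2 * C" if "\<omega> \<in> space M" for \<omega>
    using bounded[OF that] by linarith+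
  have int_hY: "integrable M (\<lambda>\<omega>. h (X \<omega>) * Y \<omega>)" by (rule prod_int) (use hb Yb in auto)
  have int_hf: "integrable M (\<lambda>\<omega>. h (X \<omega>) * f (X \<omega>))" by (rule prod_int) (use hb Yb in auto)
  have int_hh: "integrable M (\<lambda>\<omega>. h (X \<omega>) * h (X \<omega>))" by (rule prod_int) (use hb in auto)
  have int_ff: "integrable M (\<lambda>\<omega>. (f (X \<omega>) - Y \<omega>) * (f (X \<omega>) - Y \<omega>))" by (rule prod_int) (use Yb in auto)
  have "expectation (\<lambda>\<omega>. h (X \<omega>) * f (X \<omega>)) = expectation (\<lambda>\<omega>. h (X \<omega>) * real_cond_exp M ?F Y \<omega>)"
    by (rule integral_cong_AE) (use condexp in \<open>auto simp: borel_measurable_cond_exp2\<close>)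
  also have "\<dots> = expectation (\<lambda>\<omega>. h (X \<omega>) * Y \<omega>)"
    by (rule real_cond_exp_intg(2)[OF int_hY hF Y])
  finally have orth: "expectation (\<lambda>\<omega>. h (X \<omega>) * f (X \<omega>)) = expectation (\<lambda>\<omega>. h (X \<omega>) * Y \<omega>)" .
  have "expectation (\<lambda>\<omega>. (g (X \<omega>) - Y \<omega>)\<^sup>2) =
      expectation (\<lambda>\<omega>. h (X \<omega>) * h (X \<omega>) + 2 * (h (X \<omega>) * f (X \<omega>) - h (X \<omega>) * Y \<omega>)
        + (f (X \<omega>) - Y \<omega>) * (f (X \<omega>) - Y \<omega>))"
    by (intro Bochner_Integration.integral_cong refl) (simp add: h_def power2_eq_square algebra_simps)
  also have "\<dots> = expectation (\<lambda>\<omega>. h (X \<omega>) * h (X \<omega>)) + expectation (\<lambda>\<omega>. (f (X \<omega>) - Y \<omega>) * (f (X \<omega>) - Y \<omega>))"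
    using int_hY int_hf int_hh int_ff orth by simp
  finally show ?thesis by (simp add: h_def power2_eq_square)
qed

text \<open>A grid of spacing \<open>\<rho>\<close> starting at \<open>- R\<close>; rounding each
  coordinate down to the grid moves it by less than \<open>\<rho>\<close>.\<close>

lemma PiE_cube_cover:
  fixes R \<rho> :: real and I :: "'i set"
  assumes "0 < \<rho>" "0 \<le> R" "finite I"
  obtains C where "finite C" "C \<subseteq> PiE I (\<lambda>_. {-R..R})" "real (card C) \<le> max 1 (4 * R / \<rho>) ^ card I"
    "\<And>\<theta>. \<theta> \<in> PiE I (\<lambda>_. {-R..R}) \<Longrightarrow> \<exists>c\<in>C. \<forall>i\<in>I. \<bar>\<theta> i - c i\<bar> \<le> \<rho>"
proof -
  define n where "n = nat \<lfloor>2 * R / \<rho>\<rfloor>"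
  define G where "G = (\<lambda>j. - R + real j * \<rho>) ` {0..n}"
  have n: "real n \<le> 2 * R / \<rho>" unfolding n_def using assms by (simp add: of_nat_floor)
  have "real n * \<rho> \<le> 2 * R" using n assms by (simp add: field_simps)
  have G: "G \<subseteq> {-R..R}"
  proof
    fix y assume "y \<in> G"
    then obtain j where j: "y = - R + real j * \<rho>" "j \<in> {0..n}" unfolding G_def by (rule imageE)
    have "real j * \<rho> \<le> real n * \<rho>" using j assms by (intro mult_right_mono) auto
    then show "y \<in> {-R..R}" using j \<open>real n * \<rho> \<le> 2 * R\<close> \<open>real j * \<rho> \<le> real n * \<rho>\<close> assms
      mult_nonneg_nonneg[of "real j" \<rho>]
      unfolding atLeastAtMost_iff by (intro conjI) linarith+
  qed
  have near: "\<exists>y\<in>G. \<bar>x - y\<bar> \<le> \<rho>" if x: "x \<in> {-R..R}" for x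
  proof -
    define j where "j = nat \<lfloor>(x + R) / \<rho>\<rfloor>"
    have q: "0 \<le> (x + R) / \<rho>" "(x + R) / \<rho> \<le> 2 * R / \<rho>" using x assms by (auto intro: divide_right_mono)
    have "j \<le> n" unfolding j_def n_def using q by (intro nat_mono floor_mono)
    have "real j \<le> (x + R) / \<rho>" "(x + R) / \<rho> < real j + 1"
      using q(1) by (simp_all add: j_def of_nat_floor)
    then have "real j * \<rho> \<le> x + R" "x + R < (real j + 1) * \<rho>" using assms by (simp_all add: field_simps)
    then have "\<bar>x - (- R + real j * \<rho>)\<bar> \<le> \<rho>" by (simp add: algebra_simps)
    then show ?thesis using \<open>j \<le> n\<close> unfolding G_def by (intro bexI imageI) auto
  qed
  have fin: "finite G" by (simp add: G_def)
  have "card G \<le> n + 1" unfolding G_def using card_image_le[of "{0..n}"] by fastforce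
  \<comment> \<open>The bound \<open>n + 1 \<le> 2 * n\<close> for positive \<open>n\<close> turns
    \<open>2 * R / \<rho>\<close> into \<open>4 * R / \<rho>\<close>; a single grid point,
    \<open>n = 0\<close>, accounts for the maximum with 1.\<close>
  also have "real (n + 1) \<le> max 1 (4 * R / \<rho>)"
  proof (cases "n = 0")
    case False
    then have "real (n + 1) \<le> 2 * real n" by simp
    also have "\<dots> \<le> 4 * R / \<rho>" using n by simp
    finally show ?thesis by simp
  qed simp
  finally have card: "real (card G) \<le> max 1 (4 * R / \<rho>)" by simp
  show ?thesis
  proof (rule that[of "PiE I (\<lambda>_. G)"])
    show "finite (PiE I (\<lambda>_. G))" using fin assms by (intro finite_PiE)
    show "PiE I (\<lambda>_. G) \<subseteq> PiE I (\<lambda>_. {-R..R})" using G by (intro PiE_mono)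
    show "real (card (PiE I (\<lambda>_. G))) \<le> max 1 (4 * R / \<rho>) ^ card I"
      using card by (simp add: card_PiE assms power_mono)
    fix \<theta> assume \<theta>: "\<theta> \<in> PiE I (\<lambda>_. {-R..R})"
    then have "\<forall>i\<in>I. \<exists>y. y \<in> G \<and> \<bar>\<theta> i - y\<bar> \<le> \<rho>" using near by (auto simp: PiE_iff)
    then obtain c where "\<forall>i\<in>I. c i \<in> G \<and> \<bar>\<theta> i - c i\<bar> \<le> \<rho>" by metis
    then show "\<exists>c\<in>PiE I (\<lambda>_. G). \<forall>i\<in>I. \<bar>\<theta> i - c i\<bar> \<le> \<rho>"
      by (intro bexI[of _ "restrict c I"]) auto
  qed
qed

text \<open>One sample hits the cube of radius \<open>r\<close> around \<open>c\<close> with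
  probability \<open>p\<close>, at least the minimum in the exponent. By independence all samples
  miss with probability \<open>(1 - p) ^ K\<close>, which is at most
  \<open>exp (- real K * p)\<close>.\<close>

lemma (in prob_space) uniform_search_miss:
  fixes \<Theta> :: "nat \<Rightarrow> 'a \<Rightarrow> ('i \<Rightarrow> real)" and I :: "'i set" and R r :: real
  defines "S \<equiv> PiM I (\<lambda>_. borel)" and "B \<equiv> PiE I (\<lambda>_. {-R..R})"
  assumes I: "finite I" and K: "1 \<le> K" and R: "0 < R" and r: "0 \<le> r" and c: "c \<in> B"
    and indep: "indep_vars (\<lambda>_. S) \<Theta> {1..K}"
    and ident: "\<And>k. k \<in> {1..K} \<Longrightarrow> distr M S (\<Theta> k) = distr M S (\<Theta> 1)"
    and unif: "distr M S (\<Theta> 1) = uniform_measure (PiM I (\<lambda>_. lborel)) B"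
  defines "A \<equiv> {\<omega> \<in> space M. \<forall>k\<in>{1..K}. \<exists>i\<in>I. r < \<bar>\<Theta> k \<omega> i - c i\<bar>}"
  shows "A \<in> events" and "prob A \<le> exp (- real K * min 1 ((r / (2 * R)) ^ card I))"
proof -
  have \<Theta> [measurable]: "\<Theta> k \<in> measurable M S" if "k \<in> {1..K}" for k
    using indep that by (auto simp: indep_vars_def)
  define Q where "Q = PiE I (\<lambda>i. {c i - r..c i + r})"
  have Q: "Q \<in> sets S" unfolding Q_def S_def using I by (intro sets_PiM_I_finite) auto
  have B: "B \<in> sets S" unfolding B_def S_def using I by (intro sets_PiM_I_finite) auto
  have setsS: "sets (PiM I (\<lambda>_. lborel :: real measure)) = sets S" unfolding S_def by (intro sets_PiM_cong) auto
  interpret L: product_sigma_finite "\<lambda>_ :: 'i. lborel :: real measure" ..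
  have vol: "emeasure (PiM I (\<lambda>_. lborel)) (PiE I (\<lambda>i. {a i..b i})) = ennreal (\<Prod>i\<in>I. b i - a i)"
    if "\<And>i. i \<in> I \<Longrightarrow> a i \<le> b i" for a b :: "'i \<Rightarrow> real"
    using that I by (simp add: L.emeasure_PiM prod_ennreal)
  define lo hi where "lo i = max (c i - r) (- R)" and "hi i = min (c i + r) R" for i
  have ci: "- R \<le> c i" "c i \<le> R" if "i \<in> I" for i using c that by (auto simp: B_def PiE_iff)
  \<comment> \<open>If \<open>c i\<close> is an end point of \<open>{-R..R}\<close>, half of the
    interval around it is lost; therefore the guaranteed length involves \<open>r\<close> and not
    \<open>2 * r\<close>.\<close>
  have lohi: "min r (2 * R) \<le> hi i - lo i" if "i \<in> I" for i
    using ci[OF that] r by (auto simp: lo_def hi_def)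
  have le: "lo i \<le> hi i" if "i \<in> I" for i using lohi[OF that] r R by auto
  have BQ: "B \<inter> Q = PiE I (\<lambda>i. {lo i..hi i})"
    unfolding B_def Q_def lo_def hi_def by (auto simp: PiE_Int PiE_iff)
  define p where "p = prob (\<Theta> 1 -` Q \<inter> space M)"
  have "p = measure (distr M S (\<Theta> 1)) Q" unfolding p_def using Q K by (simp add: measure_distr)
  also have "\<dots> = measure (PiM I (\<lambda>_. lborel)) (B \<inter> Q) / measure (PiM I (\<lambda>_. lborel)) B"
  proof -
    have "emeasure (PiM I (\<lambda>_. lborel)) B = ennreal (\<Prod>i\<in>I. R - - R)"
      unfolding B_def using R by (subst vol) auto
    then have "emeasure (PiM I (\<lambda>_. lborel)) B \<noteq> 0" "emeasure (PiM I (\<lambda>_. lborel)) B \<noteq> \<infinity>"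
      using R by (auto simp: prod_pos)
    then show ?thesis unfolding unif using Q B setsS by (intro measure_uniform_measure) auto
  qed
  also have "measure (PiM I (\<lambda>_. lborel)) (B \<inter> Q) = (\<Prod>i\<in>I. hi i - lo i)"
    unfolding measure_def BQ using vol[of lo hi, OF le] le by (simp add: prod_nonneg)
  also have "measure (PiM I (\<lambda>_. lborel)) B = (2 * R) ^ card I"
    unfolding measure_def B_def using vol[of "\<lambda>_. - R" "\<lambda>_. R"] R by simp
  finally have p_prod: "p = (\<Prod>i\<in>I. hi i - lo i) / (2 * R) ^ card I" .
  have "(\<Prod>i\<in>I. min r (2 * R)) \<le> (\<Prod>i\<in>I. hi i - lo i)"
    using lohi r R by (intro prod_mono) auto
  then have "p \<ge> min r (2 * R) ^ card I / (2 * R) ^ card I"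
    unfolding p_prod using R by (simp add: divide_right_mono del: power_mult_distrib)
  also have "min r (2 * R) ^ card I / (2 * R) ^ card I = min (r / (2 * R)) 1 ^ card I"
    using R by (simp add: power_divide power_mult_distrib min_def)
  also have "\<dots> \<ge> min 1 ((r / (2 * R)) ^ card I)"
    by (auto simp: min_def)
  finally have p: "min 1 ((r / (2 * R)) ^ card I) \<le> p" .
  have p_eq: "prob (\<Theta> k -` Q \<inter> space M) = p" if "k \<in> {1..K}" for k
  proof -
    have "prob (\<Theta> k -` Q \<inter> space M) = measure (distr M S (\<Theta> k)) Q"
      using that Q by (simp add: measure_distr)
    also have "\<dots> = measure (distr M S (\<Theta> 1)) Q" using ident[OF that] by simp
    also have "\<dots> = p" unfolding p_def using Q K by (simp add: measure_distr)
    finally show ?thesis .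
  qed
  have compl: "\<Theta> k -` (space S - Q) \<inter> space M = space M - (\<Theta> k -` Q \<inter> space M)" if "k \<in> {1..K}" for k
    using measurable_space[OF \<Theta>[OF that]] by auto
  have A_eq: "A = (\<Inter>k\<in>{1..K}. \<Theta> k -` (space S - Q) \<inter> space M)"
  proof -
    have "\<Theta> k \<omega> \<in> Q \<longleftrightarrow> (\<forall>i\<in>I. \<bar>\<Theta> k \<omega> i - c i\<bar> \<le> r)" if "k \<in> {1..K}" "\<omega> \<in> space M" for k \<omega>
      using measurable_space[OF \<Theta>[OF that(1)] that(2)]
      by (auto simp: Q_def S_def space_PiM PiE_iff abs_le_iff algebra_simps)
    moreover have "{1..K} \<noteq> {}" using K by auto
    ultimately show ?thesis
      using measurable_space[OF \<Theta>] unfolding A_def by (auto simp: not_le)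
  qed
  show "A \<in> events"
    unfolding A_eq using K Q by (intro sets.finite_INT measurable_sets[OF \<Theta>]) auto
  have "prob A = (\<Prod>k\<in>{1..K}. prob (\<Theta> k -` (space S - Q) \<inter> space M))"
    unfolding A_eq by (rule indep_varsD_finite[OF indep]) (use K Q in auto)
  also have "\<dots> = (\<Prod>k\<in>{1..K}. 1 - p)"
  proof (intro prod.cong refl)
    fix k assume k: "k \<in> {1..K}"
    have "\<Theta> k -` Q \<inter> space M \<in> events" by (rule measurable_sets[OF \<Theta>[OF k] Q])
    then show "prob (\<Theta> k -` (space S - Q) \<inter> space M) = 1 - p"
      unfolding compl[OF k] by (simp add: prob_compl p_eq[OF k])
  qed
  also have "\<dots> = (1 - p) ^ K" by simp
  also have "\<dots> \<le> exp (- p) ^ K"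
    using exp_ge_add_one_self[of "- p"] by (intro power_mono) (auto simp: p_def)
  also have "\<dots> = exp (- real K * p)" by (simp add: exp_of_nat_mult[symmetric])
  also have "\<dots> \<le> exp (- real K * min 1 ((r / (2 * R)) ^ card I))" using p by (simp add: mult_left_mono)
  finally show "prob A \<le> exp (- real K * min 1 ((r / (2 * R)) ^ card I))" .
qed

text \<open>Factor the difference of squares. This transfers the Lipschitz dependence on the
  parameter from the network to the risks.\<close>

lemma sq_diff_le:
  fixes a b y :: real
  assumes "a \<in> {u..v}" "b \<in> {u..v}" "y \<in> {u..v}"
  shows "\<bar>(a - y)\<^sup>2 - (b - y)\<^sup>2\<bar> \<le> 2 * (v - u) * \<bar>a - b\<bar>"
proof -
  have "(a - y)\<^sup>2 - (b - y)\<^sup>2 = (a + b - 2 * y) * (a - b)" by (simp add: power2_eq_square algebra_simps)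
  moreover have "\<bar>a + b - 2 * y\<bar> \<le> 2 * (v - u)" using assms by (simp add: abs_le_iff)
  ultimately show ?thesis by (simp add: abs_mult mult_right_mono)
qed

text \<open>Hoeffding's inequality for the squared losses, which lie in an interval of length
  \<open>(v - u)\<^sup>2\<close>; its square is the fourth power in the exponent. The range is
  assumed for the first pair and passes to the others through the common law.\<close>

lemma (in prob_space) empirical_risk_deviation:
  fixes X :: "nat \<Rightarrow> 'a \<Rightarrow> 'b" and Y :: "nat \<Rightarrow> 'a \<Rightarrow> real" and g :: "'b \<Rightarrow> real"
  assumes n: "1 \<le> n" and uv: "u < v" and t: "0 \<le> t"
    and indep: "indep_vars (\<lambda>_. S \<Otimes>\<^sub>M borel) (\<lambda>m \<omega>. (X m \<omega>, Y m \<omega>)) {1..n}"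
    and ident: "\<And>m. m \<in> {1..n} \<Longrightarrow> distr M (S \<Otimes>\<^sub>M borel) (\<lambda>\<omega>. (X m \<omega>, Y m \<omega>)) =
                     distr M (S \<Otimes>\<^sub>M borel) (\<lambda>\<omega>. (X 1 \<omega>, Y 1 \<omega>))"
    and g [measurable]: "g \<in> borel_measurable S"
    and range: "\<And>\<omega>. \<omega> \<in> space M \<Longrightarrow> g (X 1 \<omega>) \<in> {u..v} \<and> Y 1 \<omega> \<in> {u..v}"
  defines "A \<equiv> {\<omega> \<in> space M. \<bar>(\<Sum>m=1..n. (g (X m \<omega>) - Y m \<omega>)\<^sup>2) / real n -
              expectation (\<lambda>\<omega>. (g (X 1 \<omega>) - Y 1 \<omega>)\<^sup>2)\<bar> \<ge> t}"
  shows "A \<in> events" and "prob A \<le> 2 * exp (- 2 * real n * t\<^sup>2 / (v - u) ^ 4)"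
proof -
  have XY [measurable]: "(\<lambda>\<omega>. (X m \<omega>, Y m \<omega>)) \<in> measurable M (S \<Otimes>\<^sub>M borel)" if "m \<in> {1..n}" for m
    using indep that by (auto simp: indep_vars_def)
  define q where "q = (\<lambda>(x, y). (g x - y)\<^sup>2)"
  have q [measurable]: "q \<in> borel_measurable (S \<Otimes>\<^sub>M borel)" unfolding q_def by measurable
  define Z where "Z m \<omega> = q (X m \<omega>, Y m \<omega>)" for m \<omega>
  have Z: "Z m \<in> borel_measurable M" if "m \<in> {1..n}" for m
    unfolding Z_def using that by measurable
  have one: "1 \<in> {1..n}" using n by simp
  \<comment> \<open>Each loss has the image of the joint law under \<open>q\<close> as its law, so
    the losses are identically distributed because the pairs are.\<close>
  have Zq: "distr M borel (Z m) = distr (distr M (S \<Otimes>\<^sub>M borel) (\<lambda>\<omega>. (X m \<omega>, Y m \<omega>))) borel q"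
    if "m \<in> {1..n}" for m
    using that by (subst distr_distr) (auto simp: Z_def[abs_def] o_def)
  interpret H: Hoeffding_ineq_iid M "{1..n}" Z "Z 1" 0 "(v - u)\<^sup>2" "expectation (Z 1)"
  proof unfold_locales
    show "indep_vars (\<lambda>_. borel) Z {1..n}"
      unfolding Z_def by (rule indep_vars_compose2[OF indep q])
    show "distr M borel (Z m) = distr M borel (Z 1)" if "m \<in> {1..n}" for m
      unfolding Zq[OF that] Zq[OF one] ident[OF that] ..
    show "Z 1 \<in> borel_measurable M" by (rule Z[OF one])
    have "\<bar>g (X 1 \<omega>) - Y 1 \<omega>\<bar> \<le> \<bar>v - u\<bar>" if "\<omega> \<in> space M" for \<omega>
      using range[OF that] unfolding atLeastAtMost_iff by linarith
    then show "AE \<omega> in M. Z 1 \<omega> \<in> {0..(v - u)\<^sup>2}"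
      by (intro AE_I2) (simp add: Z_def q_def abs_le_square_iff)
  qed simp_all
  have A_eq: "A = {\<omega> \<in> space M. \<bar>(\<Sum>m=1..n. Z m \<omega>) / real (card {1..n}) - expectation (Z 1)\<bar> \<ge> t}"
    by (simp add: A_def Z_def[abs_def] q_def)
  show "A \<in> events" unfolding A_eq using Z by measurable
  have "prob A \<le> 2 * exp (- 2 * real (card {1..n}) * t\<^sup>2 / ((v - u)\<^sup>2 - 0)\<^sup>2)"
    unfolding A_eq by (rule H.Hoeffding_ineq_abs_ge') (use t uv n in auto)
  then show "prob A \<le> 2 * exp (- 2 * real n * t\<^sup>2 / (v - u) ^ 4)" by simp
qed

text \<open>The probabilistic argument for any family \<open>F\<close> that is Lipschitz in its
  parameter with respect to the maximum norm; here \<open>\<kappa>\<close> may be any choice of an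
  empirical minimiser.\<close>

lemma (in prob_space) random_search_risk_bound:
  fixes F :: "('i \<Rightarrow> real) \<Rightarrow> 'b \<Rightarrow> real" and S :: "'b measure" and D :: "'b set" and I :: "'i set"
    and X :: "nat \<Rightarrow> 'a \<Rightarrow> 'b" and Y :: "nat \<Rightarrow> 'a \<Rightarrow> real" and f :: "'b \<Rightarrow> real"
    and \<Theta> :: "nat \<Rightarrow> 'a \<Rightarrow> ('i \<Rightarrow> real)" and \<kappa> :: "'a \<Rightarrow> nat" and R u v \<Lambda> \<epsilon> :: real
  defines "B \<equiv> PiE I (\<lambda>_. {-R..R})" and "T \<equiv> PiM I (\<lambda>_. borel)"
  assumes I: "finite I" and K: "1 \<le> K" and n: "1 \<le> n" and \<epsilon>: "0 < \<epsilon>" and uv: "u < v"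
    and R: "0 < R" and \<Lambda>: "0 < \<Lambda>"
    and indep: "indep_vars (\<lambda>_. S \<Otimes>\<^sub>M borel) (\<lambda>m \<omega>. (X m \<omega>, Y m \<omega>)) {1..n}"
    and ident: "\<And>m. m \<in> {1..n} \<Longrightarrow> distr M (S \<Otimes>\<^sub>M borel) (\<lambda>\<omega>. (X m \<omega>, Y m \<omega>)) =
                     distr M (S \<Otimes>\<^sub>M borel) (\<lambda>\<omega>. (X 1 \<omega>, Y 1 \<omega>))"
    and X_D: "\<And>m \<omega>. m \<in> {1..n} \<Longrightarrow> \<omega> \<in> space M \<Longrightarrow> X m \<omega> \<in> D"
    and Y_uv: "\<And>m \<omega>. m \<in> {1..n} \<Longrightarrow> \<omega> \<in> space M \<Longrightarrow> Y m \<omega> \<in> {u..v}"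
    and F: "\<And>\<theta>. \<theta> \<in> B \<Longrightarrow> F \<theta> \<in> borel_measurable S"
      "\<And>\<theta> x. \<theta> \<in> B \<Longrightarrow> x \<in> D \<Longrightarrow> F \<theta> x \<in> {u..v}"
    and F_lip: "\<And>\<theta> \<eta> x \<rho>. \<theta> \<in> B \<Longrightarrow> \<eta> \<in> B \<Longrightarrow> x \<in> D \<Longrightarrow> 0 \<le> \<rho> \<Longrightarrow>
      (\<And>i. i \<in> I \<Longrightarrow> \<bar>\<theta> i - \<eta> i\<bar> \<le> \<rho>) \<Longrightarrow> \<bar>F \<theta> x - F \<eta> x\<bar> \<le> \<Lambda> * \<rho>"
    and f: "f \<in> borel_measurable S" "\<And>x. x \<in> D \<Longrightarrow> f x \<in> {u..v}"
    and condexp: "AE \<omega> in M. f (X 1 \<omega>) = real_cond_exp M (vimage_algebra (space M) (X 1) S) (Y 1) \<omega>"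
    and \<eta>: "\<eta> \<in> B" "\<And>x. x \<in> D \<Longrightarrow> \<bar>F \<eta> x - f x\<bar> \<le> \<epsilon> / 2"
    and \<Theta>_B: "\<And>k \<omega>. k \<in> {1..K} \<Longrightarrow> \<omega> \<in> space M \<Longrightarrow> \<Theta> k \<omega> \<in> B"
    and \<Theta>_indep: "indep_vars (\<lambda>_. T) \<Theta> {1..K}"
    and \<Theta>_ident: "\<And>k. k \<in> {1..K} \<Longrightarrow> distr M T (\<Theta> k) = distr M T (\<Theta> 1)"
    and \<Theta>_unif: "distr M T (\<Theta> 1) = uniform_measure (PiM I (\<lambda>_. lborel)) B"
  defines "E \<equiv> \<lambda>\<theta> \<omega>. (\<Sum>m=1..n. (F \<theta> (X m \<omega>) - Y m \<omega>)\<^sup>2) / real n"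
  assumes \<kappa>: "\<And>\<omega>. \<omega> \<in> space M \<Longrightarrow> \<kappa> \<omega> \<in> {1..K}"
      "\<And>\<omega> k. \<omega> \<in> space M \<Longrightarrow> k \<in> {1..K} \<Longrightarrow> E (\<Theta> (\<kappa> \<omega>) \<omega>) \<omega> \<le> E (\<Theta> k \<omega>) \<omega>"
  shows "prob {\<omega> \<in> space M. expectation (\<lambda>\<omega>'. (F (\<Theta> (\<kappa> \<omega>) \<omega>) (X 1 \<omega>') - f (X 1 \<omega>'))\<^sup>2) > \<epsilon>\<^sup>2}
    \<le> exp (- real K * min 1 ((\<epsilon>\<^sup>2 / (16 * (v - u) * \<Lambda> * R)) ^ card I)) +
      2 * exp (real (card I) * ln (max 1 (128 * \<Lambda> * R * (v - u) / \<epsilon>\<^sup>2)) - \<epsilon> ^ 4 * real n / (32 * (v - u) ^ 4))"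
proof -
  \<comment> \<open>Moving the parameter by \<open>r\<close> changes the empirical risk by at most
    \<open>\<epsilon>\<^sup>2 / 4\<close>, moving it by \<open>\<rho>\<close> changes either risk by
    at most \<open>\<epsilon>\<^sup>2 / 16\<close>. Twice the latter plus the deviation
    \<open>\<epsilon>\<^sup>2 / 8\<close> allowed at grid points makes a uniform deviation of
    \<open>\<epsilon>\<^sup>2 / 4\<close>.\<close>
  define r where "r = \<epsilon>\<^sup>2 / (8 * (v - u) * \<Lambda>)"
  define \<rho> where "\<rho> = \<epsilon>\<^sup>2 / (32 * (v - u) * \<Lambda>)"
  have pos: "0 < r" "0 < \<rho>" using \<epsilon> uv \<Lambda> by (simp_all add: r_def \<rho>_def)
  have r: "2 * (v - u) * (\<Lambda> * r) = \<epsilon>\<^sup>2 / 4" and \<rho>: "2 * (v - u) * (\<Lambda> * \<rho>) = \<epsilon>\<^sup>2 / 16"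
    using uv \<Lambda> by (simp_all add: r_def \<rho>_def field_simps)
  obtain C where C: "finite C" "C \<subseteq> B" "real (card C) \<le> max 1 (4 * R / \<rho>) ^ card I"
    "\<And>\<theta>. \<theta> \<in> B \<Longrightarrow> \<exists>c\<in>C. \<forall>i\<in>I. \<bar>\<theta> i - c i\<bar> \<le> \<rho>"
    using PiE_cube_cover[of \<rho> R I] pos R I unfolding B_def by (metis less_imp_le)
  define risk where "risk \<theta> = expectation (\<lambda>\<omega>. (F \<theta> (X 1 \<omega>) - Y 1 \<omega>)\<^sup>2)" for \<theta>
  define A1 where "A1 = {\<omega> \<in> space M. \<forall>k\<in>{1..K}. \<exists>i\<in>I. r < \<bar>\<Theta> k \<omega> i - \<eta> i\<bar>}"
  define A2 where "A2 c = {\<omega> \<in> space M. \<bar>E c \<omega> - risk c\<bar> \<ge> \<epsilon>\<^sup>2 / 8}" for c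
  have one: "1 \<in> {1..n}" using n by simp
  have XY: "(\<lambda>\<omega>. (X 1 \<omega>, Y 1 \<omega>)) \<in> measurable M (S \<Otimes>\<^sub>M borel)"
    using indep one unfolding indep_vars_def by blast
  have X1 [measurable]: "X 1 \<in> measurable M S" and Y1 [measurable]: "Y 1 \<in> borel_measurable M"
    using measurable_compose[OF XY measurable_fst] measurable_compose[OF XY measurable_snd] by simp_all
  have A1: "A1 \<in> events" "prob A1 \<le> exp (- real K * min 1 ((r / (2 * R)) ^ card I))"
    unfolding A1_def
    by (rule uniform_search_miss[OF I K R less_imp_le[OF pos(1)] \<eta>(1)[unfolded B_def] \<Theta>_indep[unfolded T_def]
      \<Theta>_ident[unfolded T_def] \<Theta>_unif[unfolded T_def B_def]]; assumption)+
  have A2: "A2 c \<in> events" "prob (A2 c) \<le> 2 * exp (- (\<epsilon> ^ 4 * real n / (32 * (v - u) ^ 4)))" if "c \<in> C" for c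
  proof -
    have c: "c \<in> B" using that C by blast
    have rng: "F c (X 1 \<omega>) \<in> {u..v} \<and> Y 1 \<omega> \<in> {u..v}" if "\<omega> \<in> space M" for \<omega>
      using F(2)[OF c X_D[OF one that]] Y_uv[OF one that] by blast
    have t: "0 \<le> \<epsilon>\<^sup>2 / 8" by simp
    show "A2 c \<in> events" unfolding A2_def E_def risk_def
      by (rule empirical_risk_deviation(1)[OF n uv t indep ident F(1)[OF c] rng])
    have "prob (A2 c) \<le> 2 * exp (- 2 * real n * (\<epsilon>\<^sup>2 / 8)\<^sup>2 / (v - u) ^ 4)"
      unfolding A2_def E_def risk_def
      by (rule empirical_risk_deviation(2)[OF n uv t indep ident F(1)[OF c] rng])
    also have "- 2 * real n * (\<epsilon>\<^sup>2 / 8)\<^sup>2 / (v - u) ^ 4 = - (\<epsilon> ^ 4 * real n / (32 * (v - u) ^ 4))"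
      by (simp add: power_divide field_simps flip: power_mult)
    finally show "prob (A2 c) \<le> 2 * exp (- (\<epsilon> ^ 4 * real n / (32 * (v - u) ^ 4)))" .
  qed
  have sq_le: "\<bar>(F \<theta> (X m \<omega>) - Y m \<omega>)\<^sup>2 - (F c (X m \<omega>) - Y m \<omega>)\<^sup>2\<bar> \<le> 2 * (v - u) * (\<Lambda> * s)"
    if "m \<in> {1..n}" "\<omega> \<in> space M" "\<theta> \<in> B" "c \<in> B" "0 \<le> s" "\<And>i. i \<in> I \<Longrightarrow> \<bar>\<theta> i - c i\<bar> \<le> s" for m \<omega> \<theta> c s
  proof -
    note x = X_D[OF that(1,2)]
    have "\<bar>(F \<theta> (X m \<omega>) - Y m \<omega>)\<^sup>2 - (F c (X m \<omega>) - Y m \<omega>)\<^sup>2\<bar> \<le> 2 * (v - u) * \<bar>F \<theta> (X m \<omega>) - F c (X m \<omega>)\<bar>"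
      by (intro sq_diff_le F x Y_uv that)
    also have "\<dots> \<le> 2 * (v - u) * (\<Lambda> * s)"
      using uv by (intro mult_left_mono F_lip x that) auto
    finally show ?thesis .
  qed
  have E_lip: "\<bar>E \<theta> \<omega> - E c \<omega>\<bar> \<le> 2 * (v - u) * (\<Lambda> * s)"
    if "\<omega> \<in> space M" "\<theta> \<in> B" "c \<in> B" "0 \<le> s" "\<And>i. i \<in> I \<Longrightarrow> \<bar>\<theta> i - c i\<bar> \<le> s" for \<omega> \<theta> c s
  proof -
    have "\<bar>E \<theta> \<omega> - E c \<omega>\<bar> = \<bar>\<Sum>m=1..n. (F \<theta> (X m \<omega>) - Y m \<omega>)\<^sup>2 - (F c (X m \<omega>) - Y m \<omega>)\<^sup>2\<bar> / real n"
      by (simp add: E_def sum_subtractf flip: diff_divide_distrib)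
    also have "\<dots> \<le> (\<Sum>m=1..n. 2 * (v - u) * (\<Lambda> * s)) / real n"
      by (intro divide_right_mono order.trans[OF sum_abs sum_mono] sq_le that) auto
    also have "\<dots> = 2 * (v - u) * (\<Lambda> * s)" using n by simp
    finally show ?thesis .
  qed
  have integ: "integrable M (\<lambda>\<omega>. (F \<theta> (X 1 \<omega>) - Y 1 \<omega>)\<^sup>2)" if "\<theta> \<in> B" for \<theta>
  proof (rule integrable_const_bound[where B = "(v - u)\<^sup>2"])
    have "\<bar>F \<theta> (X 1 \<omega>) - Y 1 \<omega>\<bar> \<le> \<bar>v - u\<bar>" if "\<omega> \<in> space M" for \<omega>
      using F(2)[OF \<open>\<theta> \<in> B\<close> X_D[OF one that]] Y_uv[OF one that] unfolding atLeastAtMost_iff by linarith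
    then show "AE \<omega> in M. norm ((F \<theta> (X 1 \<omega>) - Y 1 \<omega>)\<^sup>2) \<le> (v - u)\<^sup>2"
      by (intro AE_I2) (simp add: abs_le_square_iff)
    note [measurable] = F(1)[OF that]
    show "(\<lambda>\<omega>. (F \<theta> (X 1 \<omega>) - Y 1 \<omega>)\<^sup>2) \<in> borel_measurable M" by measurable
  qed
  have risk_lip: "\<bar>risk \<theta> - risk c\<bar> \<le> 2 * (v - u) * (\<Lambda> * s)"
    if "\<theta> \<in> B" "c \<in> B" "0 \<le> s" "\<And>i. i \<in> I \<Longrightarrow> \<bar>\<theta> i - c i\<bar> \<le> s" for \<theta> c s
  proof -
    have "\<bar>risk \<theta> - risk c\<bar> = \<bar>expectation (\<lambda>\<omega>. (F \<theta> (X 1 \<omega>) - Y 1 \<omega>)\<^sup>2 - (F c (X 1 \<omega>) - Y 1 \<omega>)\<^sup>2)\<bar>"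
      using integ that by (simp add: risk_def)
    also have "\<dots> \<le> expectation (\<lambda>\<omega>. \<bar>(F \<theta> (X 1 \<omega>) - Y 1 \<omega>)\<^sup>2 - (F c (X 1 \<omega>) - Y 1 \<omega>)\<^sup>2\<bar>)"
      by (rule integral_abs_bound)
    also have "\<dots> \<le> 2 * (v - u) * (\<Lambda> * s)"
      using integ that one by (intro integral_le_const AE_I2 sq_le integrable_abs Bochner_Integration.integrable_diff) auto
    finally show ?thesis .
  qed
  define W where "W \<theta> = expectation (\<lambda>\<omega>. (F \<theta> (X 1 \<omega>) - f (X 1 \<omega>))\<^sup>2)" for \<theta>
  define risk_f where "risk_f = expectation (\<lambda>\<omega>. (f (X 1 \<omega>) - Y 1 \<omega>)\<^sup>2)"
  have W: "W \<theta> = risk \<theta> - risk_f" if "\<theta> \<in> B" for \<theta>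
    unfolding W_def risk_def risk_f_def
  proof (rule excess_risk_eq[OF X1 Y1 f(1) F(1)[OF that] _ condexp])
    fix \<omega> assume \<omega>: "\<omega> \<in> space M"
    show "\<bar>Y 1 \<omega>\<bar> \<le> \<bar>u\<bar> + \<bar>v\<bar> \<and> \<bar>f (X 1 \<omega>)\<bar> \<le> \<bar>u\<bar> + \<bar>v\<bar> \<and> \<bar>F \<theta> (X 1 \<omega>)\<bar> \<le> \<bar>u\<bar> + \<bar>v\<bar>"
      using F(2)[OF that X_D[OF one \<omega>]] f(2)[OF X_D[OF one \<omega>]] Y_uv[OF one \<omega>]
      unfolding atLeastAtMost_iff by (intro conjI) linarith+
  qed
  have W_\<eta>: "W \<eta> \<le> \<epsilon>\<^sup>2 / 4"
    unfolding W_def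
  proof (rule integral_le_const)
    have b: "(F \<eta> (X 1 \<omega>) - f (X 1 \<omega>))\<^sup>2 \<le> \<epsilon>\<^sup>2 / 4" if "\<omega> \<in> space M" for \<omega>
    proof -
      have "(F \<eta> (X 1 \<omega>) - f (X 1 \<omega>))\<^sup>2 \<le> (\<epsilon> / 2)\<^sup>2"
        using \<eta>(2)[OF X_D[OF one that]] \<epsilon> by (subst abs_le_square_iff[symmetric]) auto
      then show ?thesis by (simp add: power_divide)
    qed
    then show "AE \<omega> in M. (F \<eta> (X 1 \<omega>) - f (X 1 \<omega>))\<^sup>2 \<le> \<epsilon>\<^sup>2 / 4" by (intro AE_I2)
    note [measurable] = F(1)[OF \<eta>(1)] f(1)
    show "integrable M (\<lambda>\<omega>. (F \<eta> (X 1 \<omega>) - f (X 1 \<omega>))\<^sup>2)"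
    proof (rule integrable_const_bound[where B = "\<epsilon>\<^sup>2 / 4"])
      show "AE \<omega> in M. norm ((F \<eta> (X 1 \<omega>) - f (X 1 \<omega>))\<^sup>2) \<le> \<epsilon>\<^sup>2 / 4"
        using b by (intro AE_I2) simp
    qed measurable
  qed
  let ?bad = "{\<omega> \<in> space M. W (\<Theta> (\<kappa> \<omega>) \<omega>) > \<epsilon>\<^sup>2}"
  \<comment> \<open>Outside the exceptional events the argument is deterministic: a grid point
    controls every parameter, and some sample is close to \<open>\<eta>\<close>.\<close>
  have sub: "?bad \<subseteq> A1 \<union> (\<Union>c\<in>C. A2 c)"
  proof (rule subsetI, rule ccontr)
    fix \<omega> assume bad: "\<omega> \<in> ?bad" and good: "\<omega> \<notin> A1 \<union> (\<Union>c\<in>C. A2 c)"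
    then have \<omega>: "\<omega> \<in> space M" by simp
    have dev: "\<bar>E \<theta> \<omega> - risk \<theta>\<bar> \<le> \<epsilon>\<^sup>2 / 4" if \<theta>: "\<theta> \<in> B" for \<theta>
    proof -
      obtain c where c: "c \<in> C" "\<forall>i\<in>I. \<bar>\<theta> i - c i\<bar> \<le> \<rho>" using C(4)[OF \<theta>] by blast
      have cB: "c \<in> B" using c C by blast
      have "\<bar>E \<theta> \<omega> - E c \<omega>\<bar> \<le> \<epsilon>\<^sup>2 / 16" "\<bar>risk \<theta> - risk c\<bar> \<le> \<epsilon>\<^sup>2 / 16"
        using E_lip[OF \<omega> \<theta> cB, of \<rho>] risk_lip[OF \<theta> cB, of \<rho>] c pos unfolding \<rho> by auto
      moreover have "\<bar>E c \<omega> - risk c\<bar> < \<epsilon>\<^sup>2 / 8" using good \<omega> c by (auto simp: A2_def)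
      ultimately show ?thesis by linarith
    qed
    obtain k where k: "k \<in> {1..K}" "\<forall>i\<in>I. \<bar>\<Theta> k \<omega> i - \<eta> i\<bar> \<le> r"
      using good \<omega> by (auto simp: A1_def not_less)
    let ?\<xi> = "\<Theta> (\<kappa> \<omega>) \<omega>"
    have \<xi>: "?\<xi> \<in> B" by (intro \<Theta>_B \<kappa> \<omega>)
    have "E ?\<xi> \<omega> \<le> E (\<Theta> k \<omega>) \<omega>" by (intro \<kappa> \<omega> k)
    moreover have "\<bar>E (\<Theta> k \<omega>) \<omega> - E \<eta> \<omega>\<bar> \<le> \<epsilon>\<^sup>2 / 4"
      using E_lip[OF \<omega> \<Theta>_B[OF k(1) \<omega>] \<eta>(1), of r] k pos unfolding r by auto
    \<comment> \<open>The budget consists of four quarters of \<open>\<epsilon>\<^sup>2\<close>: the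
      deviations at \<open>?\<xi>\<close> and at \<open>\<eta>\<close>, the distance of the good
      sample to \<open>\<eta>\<close>, and \<open>W \<eta>\<close>. The risk of \<open>f\<close>
      cancels.\<close>
    ultimately have "W ?\<xi> \<le> \<epsilon>\<^sup>2"
      using dev[OF \<xi>] dev[OF \<eta>(1)] W[OF \<xi>] W[OF \<eta>(1)] W_\<eta> by linarith
    then show False using bad by simp
  qed
  \<comment> \<open>Monotonicity asks for measurability of the larger set only.\<close>
  have "prob ?bad \<le> prob (A1 \<union> (\<Union>c\<in>C. A2 c))"
    by (rule finite_measure_mono[OF sub]) (use A1(1) A2(1) C(1) in auto)
  also have "\<dots> \<le> prob A1 + prob (\<Union>c\<in>C. A2 c)"
    by (rule measure_Un_le) (use A1(1) A2(1) C(1) in auto)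
  also have "prob (\<Union>c\<in>C. A2 c) \<le> (\<Sum>c\<in>C. prob (A2 c))"
    by (rule measure_UNION_le) (use A2(1) C(1) in auto)
  also have "\<dots> \<le> (\<Sum>c\<in>C. 2 * exp (- (\<epsilon> ^ 4 * real n / (32 * (v - u) ^ 4))))"
    by (intro sum_mono A2)
  also have "\<dots> = real (card C) * (2 * exp (- (\<epsilon> ^ 4 * real n / (32 * (v - u) ^ 4))))" by simp
  also have "\<dots> \<le> max 1 (4 * R / \<rho>) ^ card I * (2 * exp (- (\<epsilon> ^ 4 * real n / (32 * (v - u) ^ 4))))"
    by (intro mult_right_mono C) auto
  also have "4 * R / \<rho> = 128 * \<Lambda> * R * (v - u) / \<epsilon>\<^sup>2"
    using \<epsilon> uv \<Lambda> by (simp add: \<rho>_def field_simps)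
  also have "max 1 (128 * \<Lambda> * R * (v - u) / \<epsilon>\<^sup>2) ^ card I =
      exp (real (card I) * ln (max 1 (128 * \<Lambda> * R * (v - u) / \<epsilon>\<^sup>2)))"
    by (simp add: exp_of_nat_mult)
  also have "exp (real (card I) * ln (max 1 (128 * \<Lambda> * R * (v - u) / \<epsilon>\<^sup>2))) *
        (2 * exp (- (\<epsilon> ^ 4 * real n / (32 * (v - u) ^ 4)))) =
      2 * exp (real (card I) * ln (max 1 (128 * \<Lambda> * R * (v - u) / \<epsilon>\<^sup>2)) - \<epsilon> ^ 4 * real n / (32 * (v - u) ^ 4))"
    by (simp add: exp_diff exp_minus field_simps)
  also have "prob A1 \<le> exp (- real K * min 1 ((\<epsilon>\<^sup>2 / (16 * (v - u) * \<Lambda> * R)) ^ card I))"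
    using A1(2) by (simp add: r_def mult_ac)
  finally show ?thesis unfolding W_def by (simp add: add.commute)
qed

section \<open>The overall error\<close>

text \<open>Connects the product sigma-algebra on extensional functions with the Borel sets of the
  topology on all functions, to which compactness of \<open>D\<close> refers. Coordinates outside
  \<open>I\<close> are constantly \<open>undefined\<close>.\<close>

lemma PiM_identity_borel_measurable:
  "(\<lambda>x. x) \<in> measurable (PiM I (\<lambda>_. borel)) (borel :: ('i::countable \<Rightarrow> 'b::second_countable_topology) measure)"
proof (rule measurable_coordinatewise_then_product)
  fix i
  show "(\<lambda>x. x i) \<in> borel_measurable (PiM I (\<lambda>_. borel :: 'b measure))"
  proof (cases "i \<in> I")
    case False
    then have "x i = undefined" if "x \<in> space (PiM I (\<lambda>_. borel :: 'b measure))" for x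
      using that by (auto simp: space_PiM PiE_iff extensional_def)
    then show ?thesis by (subst measurable_cong[where g = "\<lambda>_. undefined"]) auto
  qed (rule measurable_component_singleton)
qed

text \<open>In the product topology the finite sum of coordinate distances to \<open>x\<close> tends
  to 0 at \<open>x\<close> and dominates the increments of \<open>\<phi>\<close>. Continuity is what
  makes \<open>\<phi>\<close> measurable on \<open>D\<close>.\<close>

lemma lipschitz_l1_continuous_on:
  fixes \<phi> :: "(nat \<Rightarrow> real) \<Rightarrow> real"
  assumes "\<And>x y. x \<in> D \<Longrightarrow> y \<in> D \<Longrightarrow> \<bar>\<phi> x - \<phi> y\<bar> \<le> L * (\<Sum>i=1..d. \<bar>x i - y i\<bar>)"
  shows "continuous_on D \<phi>"
  unfolding continuous_on_def
proof
  fix x assume x: "x \<in> D"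
  have "continuous_on D (\<lambda>y. L * (\<Sum>i=1..d. \<bar>y i - x i\<bar>))"
    by (intro continuous_on_mult continuous_on_sum continuous_on_rabs continuous_on_diff continuous_on_const
        continuous_on_product_then_coordinatewise[OF continuous_on_id])
  then have lim: "((\<lambda>y. L * (\<Sum>i=1..d. \<bar>y i - x i\<bar>)) \<longlongrightarrow> 0) (at x within D)"
    using x unfolding continuous_on_def by fastforce
  have "((\<lambda>y. \<phi> y - \<phi> x) \<longlongrightarrow> 0) (at x within D)"
    by (rule Lim_null_comparison[OF _ lim]) (use assms x in \<open>auto simp: eventually_at_topological\<close>)
  then show "(\<phi> \<longlongrightarrow> \<phi> x) (at x within D)" by (simp add: Lim_null[of \<phi>])
qed

theorem theorem4p5:
  fixes P :: "'a measure"
    and d dd K M N l :: nat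
    and \<epsilon> L u v R :: real
    and D :: "(nat \<Rightarrow> real) set"
    and X :: "nat \<Rightarrow> 'a \<Rightarrow> (nat \<Rightarrow> real)"
    and Y :: "nat \<Rightarrow> 'a \<Rightarrow> real"
    and \<phi> :: "(nat \<Rightarrow> real) \<Rightarrow> real"
    and ll :: "nat \<Rightarrow> nat"
    and \<Theta> :: "nat \<Rightarrow> 'a \<Rightarrow> (nat \<Rightarrow> real)"
    and \<delta> :: "(nat \<Rightarrow> real) \<Rightarrow> (nat \<Rightarrow> real) \<Rightarrow> real"
    and B :: "(nat \<Rightarrow> real) set"
    and \<E> :: "(nat \<Rightarrow> real) \<Rightarrow> 'a \<Rightarrow> real"
    and \<Xi> :: "'a \<Rightarrow> (nat \<Rightarrow> real)"
  assumes P: "prob_space P"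
    and pos: "d \<ge> 1" "dd \<ge> 1" "K \<ge> 1" "M \<ge> 1"
    and eps: "\<epsilon> > 0"
    and uv: "u < v"
    and D_sub: "D \<subseteq> PiE {1..d} (\<lambda>_. UNIV)"
    and D_compact: "compact D"
    and D_two: "\<exists>x\<in>D. \<exists>y\<in>D. x \<noteq> y"
    and X_D: "\<And>m \<omega>. m \<in> {1..M} \<Longrightarrow> \<omega> \<in> space P \<Longrightarrow> X m \<omega> \<in> D"
    and Y_uv: "\<And>m \<omega>. m \<in> {1..M} \<Longrightarrow> \<omega> \<in> space P \<Longrightarrow> Y m \<omega> \<in> {u..v}"
    and XY_indep: "prob_space.indep_vars P (\<lambda>_. PiM {1..d} (\<lambda>_. borel) \<Otimes>\<^sub>M borel)
                      (\<lambda>m \<omega>. (X m \<omega>, Y m \<omega>)) {1..M}"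
    and XY_ident: "\<And>m. m \<in> {1..M} \<Longrightarrow>
                     distr P (PiM {1..d} (\<lambda>_. borel) \<Otimes>\<^sub>M borel) (\<lambda>\<omega>. (X m \<omega>, Y m \<omega>)) =
                     distr P (PiM {1..d} (\<lambda>_. borel) \<Otimes>\<^sub>M borel) (\<lambda>\<omega>. (X 1 \<omega>, Y 1 \<omega>))"
    and \<delta>_def: "\<delta> = (\<lambda>x y. \<Sum>i=1..d. \<bar>x i - y i\<bar>)"
    and \<phi>_range: "\<And>x. x \<in> D \<Longrightarrow> \<phi> x \<in> {u..v}"
    and \<phi>_condexp: "AE \<omega> in P. \<phi> (X 1 \<omega>) =
        real_cond_exp P (vimage_algebra (space P) (X 1) (PiM {1..d} (\<lambda>_. borel))) (Y 1) \<omega>"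
    and \<phi>_lip: "\<And>x y. x \<in> D \<Longrightarrow> y \<in> D \<Longrightarrow> \<bar>\<phi> x - \<phi> y\<bar> \<le> L * \<delta> x y"
    and N_ge: "enat N \<ge> max 2 (covering_number D \<delta> (ereal \<epsilon> / ereal (4 * L)))"
    and l_gt: "l > N"
    and ll_pos: "\<And>i. i \<le> l \<Longrightarrow> ll i \<ge> 1"
    and ll_0: "ll 0 = d"
    and ll_1: "ll 1 \<ge> 2 * d * N"
    and ll_mid: "\<And>i. i \<in> {2..N} \<Longrightarrow> int (ll i) \<ge> 2 * int N - 2 * int i + 3"
    and ll_tail: "\<And>j. j \<in> {N..<l} \<Longrightarrow> ll j \<ge> 2"
    and ll_l: "ll l = 1"
    and ll_dd: "param_count ll l \<le> dd"
    and R_ge: "R \<ge> Max {1, L, Sup ((\<lambda>z. Max ((\<lambda>i. \<bar>z i\<bar>) ` {1..d})) ` D),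
                           2 * Sup ((\<lambda>z. \<bar>\<phi> z\<bar>) ` D)}"
    and B_def: "B = PiE {1..dd} (\<lambda>_. {-R..R})"
    and \<E>_def: "\<E> = (\<lambda>\<theta> \<omega>. (\<Sum>m=1..M. \<bar>clipped_net \<theta> ll l u v (X m \<omega>) 1 - Y m \<omega>\<bar>^2) / real M)"
    and \<Theta>_B: "\<And>k \<omega>. k \<in> {1..K} \<Longrightarrow> \<omega> \<in> space P \<Longrightarrow> \<Theta> k \<omega> \<in> B"
    and \<Theta>_indep: "prob_space.indep_vars P (\<lambda>_. PiM {1..dd} (\<lambda>_. borel)) \<Theta> {1..K}"
    and \<Theta>_ident: "\<And>k. k \<in> {1..K} \<Longrightarrow>
                     distr P (PiM {1..dd} (\<lambda>_. borel)) (\<Theta> k) = distr P (PiM {1..dd} (\<lambda>_. borel)) (\<Theta> 1)"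
    and \<Theta>_unif: "distr P (PiM {1..dd} (\<lambda>_. borel)) (\<Theta> 1) = uniform_measure (PiM {1..dd} (\<lambda>_. lborel)) B"
    and \<Xi>_def: "\<Xi> = (\<lambda>\<omega>. \<Theta> (LEAST k. k \<in> {1..K} \<and>
                        \<E> (\<Theta> k \<omega>) \<omega> = Min ((\<lambda>j. \<E> (\<Theta> j \<omega>) \<omega>) ` {1..K})) \<omega>)"
  shows "measure P {\<omega> \<in> space P.
            (\<integral>\<^sup>+ x. ennreal (\<bar>clipped_net (\<Xi> \<omega>) ll l u v x 1 - \<phi> x\<bar>^2)
               \<partial>distr P (PiM {1..d} (\<lambda>_. borel)) (X 1)) > ennreal (\<epsilon>^2)}
         \<le> exp (- real K * min 1 (\<epsilon> ^ (2 * dd) /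
                 (16 * (v - u) * real l * (real (Max (ll ` {0..l})) + 1) ^ l * R ^ (l + 1)) ^ dd))
           + 2 * exp (real dd * ln (max 1 (128 * real l * (real (Max (ll ` {0..l})) + 1) ^ l
                                           * R ^ (l + 1) * (v - u) / \<epsilon>^2))
                      - \<epsilon>^4 * real M / (32 * (v - u)^4))"
proof -
  interpret prob_space P by (rule P)
  define S where "S = PiM {1..d} (\<lambda>_. borel :: real measure)"
  define w where "w = Max (ll ` {0..l})"
  define \<Lambda> where "\<Lambda> = real l * (real w + 1) ^ l * R ^ l"
  define F where "F \<theta> x = clipped_net \<theta> ll l u v x 1" for \<theta> x
  \<comment> \<open>\<open>\<phi>\<close> is controlled on \<open>D\<close> only; its extension by 0
    is measurable on the whole space and agrees with it wherever \<open>X\<close> takes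
    values.\<close>
  define f where "f x = indicator D x *\<^sub>R \<phi> x" for x
  have ll_w: "ll i \<le> w" if "i \<le> l" for i unfolding w_def using that by (intro Max_ge) auto

  \<comment> \<open>Bounds on the domain, the target function and the Lipschitz constant\<close>
  have one: "1 \<in> {1..M}" using pos by simp
  have D_ne: "D \<noteq> {}" using D_two by blast
  have cont_coord: "continuous_on D (\<lambda>z. z i)" for i
    by (rule continuous_on_product_then_coordinatewise[OF continuous_on_id])
  have "\<exists>c. \<forall>z\<in>D. \<bar>z i\<bar> \<le> c" for i
  proof -
    have "bounded ((\<lambda>z. z i) ` D)"
      using compact_continuous_image[OF cont_coord D_compact] by (rule compact_imp_bounded)
    then show ?thesis unfolding bounded_iff by auto
  qed
  then obtain c where c: "\<And>z i. z \<in> D \<Longrightarrow> \<bar>z i\<bar> \<le> c i" by metis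
  \<comment> \<open>A real supremum dominates its elements only when the set is bounded above;
    compactness of \<open>D\<close>, coordinate by coordinate, provides this.\<close>
  have "bdd_above ((\<lambda>z. Max ((\<lambda>i. \<bar>z i\<bar>) ` {1..d})) ` D)"
  proof (rule bdd_aboveI2)
    fix z assume z: "z \<in> D"
    have "\<bar>z i\<bar> \<le> (\<Sum>i=1..d. c i)" if "i \<in> {1..d}" for i
    proof -
      have "0 \<le> c j" for j using c[OF z, of j] by linarith
      then have "c i \<le> (\<Sum>i=1..d. c i)" using that by (intro member_le_sum) auto
      then show ?thesis using c[OF z, of i] by linarith
    qed
    then show "Max ((\<lambda>i. \<bar>z i\<bar>) ` {1..d}) \<le> (\<Sum>i=1..d. c i)" using pos by simp
  qed
  note Sup1 = cSUP_upper[OF _ this]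
  have "bdd_above ((\<lambda>z. \<bar>\<phi> z\<bar>) ` D)"
  proof (rule bdd_aboveI2)
    fix z assume "z \<in> D"
    then show "\<bar>\<phi> z\<bar> \<le> \<bar>u\<bar> + \<bar>v\<bar>" using \<phi>_range[of z] unfolding atLeastAtMost_iff by linarith
  qed
  note Sup2 = cSUP_upper[OF _ this]
  have R: "1 \<le> R" "L \<le> R" "Sup ((\<lambda>z. Max ((\<lambda>i. \<bar>z i\<bar>) ` {1..d})) ` D) \<le> R"
    "2 * Sup ((\<lambda>z. \<bar>\<phi> z\<bar>) ` D) \<le> R"
    by (rule order.trans[OF Max_ge R_ge]; simp)+
  have D_R: "\<bar>z i\<bar> \<le> R" if "z \<in> D" "i \<in> {1..d}" for z i
  proof -
    have "\<bar>z i\<bar> \<le> Max ((\<lambda>i. \<bar>z i\<bar>) ` {1..d})" using that by (intro Max_ge) auto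
    then show ?thesis using Sup1[OF that(1)] R(3) by linarith
  qed
  have \<phi>_R: "2 * \<bar>\<phi> z\<bar> \<le> R" if "z \<in> D" for z using Sup2[OF that] R(4) by linarith
  have lip: "\<bar>\<phi> x - \<phi> y\<bar> \<le> L * (\<Sum>i=1..d. \<bar>x i - y i\<bar>)" if "x \<in> D" "y \<in> D" for x y
    using \<phi>_lip[OF that] by (simp add: \<delta>_def)
  \<comment> \<open>Two distinct points of \<open>D\<close> differ in a coordinate within
    \<open>{1..d}\<close> by extensionality, so their distance is positive and a negative
    \<open>L\<close> would contradict the Lipschitz condition.\<close>
  have L: "0 \<le> L"
  proof -
    obtain x y where xy: "x \<in> D" "y \<in> D" "x \<noteq> y" using D_two by blast
    obtain i where i: "i \<in> {1..d}" "x i \<noteq> y i"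
      using PiE_ext[OF subsetD[OF D_sub xy(1)] subsetD[OF D_sub xy(2)]] xy(3) by blast
    have "0 < (\<Sum>i=1..d. \<bar>x i - y i\<bar>)" by (rule sum_pos2[OF _ i(1)]) (use i in auto)
    moreover have "0 \<le> L * (\<Sum>i=1..d. \<bar>x i - y i\<bar>)" using lip[OF xy(1,2)] by linarith
    ultimately show ?thesis by (simp add: zero_le_mult_iff)
  qed
  have N: "2 \<le> N" "covering_number D \<delta> (ereal \<epsilon> / ereal (4 * L)) \<le> enat N"
  proof -
    have "(2 :: enat) \<le> enat N" using N_ge by simp
    then show "2 \<le> N" by (simp add: numeral_eq_enat)
  qed (use N_ge in simp)
  have "\<exists>\<eta>. \<eta> \<in> PiE {1..dd} (\<lambda>_. {-R..R}) \<and> (\<forall>x\<in>D. \<bar>clipped_net \<eta> ll l u v x 1 - \<phi> x\<bar> \<le> \<epsilon> / 2)"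
  proof (rule lipschitz_approximation[where N = N and l = l and d = d and ll = ll and dd = dd and R = R
        and L = L and D = D and \<phi> = \<phi> and u = u and v = v and \<epsilon> = \<epsilon>])
    show "\<exists>\<eta>. \<eta> \<in> PiE {1..dd} (\<lambda>_. {-R..R}) \<and> (\<forall>x\<in>D. \<bar>clipped_net \<eta> ll l u v x 1 - \<phi> x\<bar> \<le> \<epsilon> / 2)"
      if "\<theta> \<in> PiE {1..dd} (\<lambda>_. {-R..R})"
        "\<And>x. x \<in> D \<Longrightarrow> \<bar>clipped_net \<theta> ll l u v x 1 - \<phi> x\<bar> \<le> \<epsilon> / 2" for \<theta>
      using that by blast
  qed (fact N(1) l_gt pos(1) ll_0 ll_1 ll_mid ll_tail ll_l ll_dd R(1,2) L D_ne
          D_R \<phi>_R \<phi>_range lip eps N(2)[unfolded \<delta>_def])+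
  then obtain \<eta> where \<eta>: "\<eta> \<in> PiE {1..dd} (\<lambda>_. {-R..R})"
    "\<And>x. x \<in> D \<Longrightarrow> \<bar>clipped_net \<eta> ll l u v x 1 - \<phi> x\<bar> \<le> \<epsilon> / 2" by blast

  \<comment> \<open>Measurability, and the error as an expectation\<close>
  have id_S: "(\<lambda>x. x) \<in> measurable S borel" unfolding S_def by (rule PiM_identity_borel_measurable)
  have D_borel: "D \<in> sets borel" using D_compact by (rule borel_compact)
  have f_meas: "f \<in> borel_measurable S"
    using measurable_compose[OF id_S borel_measurable_continuous_on_indicator[OF D_borel lipschitz_l1_continuous_on[OF lip]]]
    unfolding f_def .
  have F_meas: "F \<theta> \<in> borel_measurable S" for \<theta>
    unfolding F_def[abs_def] S_def
    by (rule clipped_net_measurable) (auto simp: ll_0 ll_l intro!: measurable_component_singleton)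
  have F_range: "F \<theta> x \<in> {u..v}" for \<theta> x
    unfolding F_def by (rule clipped_net_range) (use uv ll_l in auto)
  have f_D: "f x = \<phi> x" if "x \<in> D" for x using that by (simp add: f_def)
  have X1: "X 1 \<in> measurable P S"
  proof -
    have "(\<lambda>\<omega>. (X 1 \<omega>, Y 1 \<omega>)) \<in> measurable P (S \<Otimes>\<^sub>M borel)"
      using XY_indep one unfolding indep_vars_def S_def by blast
    from measurable_compose[OF this measurable_fst] show ?thesis by simp
  qed
  \<comment> \<open>The law of \<open>X 1\<close> is concentrated on \<open>D\<close>, so
    \<open>\<phi>\<close> may be replaced by \<open>f\<close>; boundedness then makes the integral a
    finite expectation.\<close>
  have risk: "(\<integral>\<^sup>+ x. ennreal (\<bar>clipped_net \<theta> ll l u v x 1 - \<phi> x\<bar>^2) \<partial>distr P S (X 1)) =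
      ennreal (expectation (\<lambda>\<omega>. (F \<theta> (X 1 \<omega>) - f (X 1 \<omega>))\<^sup>2))" for \<theta>
  proof -
    have D_sets: "{x \<in> space S. x \<in> D} \<in> sets S"
      using measurable_sets[OF id_S D_borel] by (simp add: vimage_def Int_def conj_commute)
    have "AE x in distr P S (X 1). x \<in> D"
      unfolding AE_distr_iff[OF X1 D_sets] using X_D[OF one] by (intro AE_I2)
    then have "(\<integral>\<^sup>+ x. ennreal (\<bar>clipped_net \<theta> ll l u v x 1 - \<phi> x\<bar>^2) \<partial>distr P S (X 1)) =
        (\<integral>\<^sup>+ x. ennreal ((F \<theta> x - f x)\<^sup>2) \<partial>distr P S (X 1))"
      by (intro nn_integral_cong_AE) (auto simp: f_D F_def elim!: eventually_mono)
    also have "\<dots> = (\<integral>\<^sup>+ \<omega>. ennreal ((F \<theta> (X 1 \<omega>) - f (X 1 \<omega>))\<^sup>2) \<partial>P)"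
    proof (rule nn_integral_distr[OF X1])
      note [measurable] = F_meas[of \<theta>] f_meas
      have "(\<lambda>x. ennreal ((F \<theta> x - f x)\<^sup>2)) \<in> borel_measurable S" by measurable
      then show "(\<lambda>x. ennreal ((F \<theta> x - f x)\<^sup>2)) \<in> borel_measurable (distr P S (X 1))" by simp
    qed
    also have "\<dots> = ennreal (expectation (\<lambda>\<omega>. (F \<theta> (X 1 \<omega>) - f (X 1 \<omega>))\<^sup>2))"
    proof (rule nn_integral_eq_integral)
      have "\<bar>F \<theta> (X 1 \<omega>) - f (X 1 \<omega>)\<bar> \<le> \<bar>v - u\<bar>" if "\<omega> \<in> space P" for \<omega>
        using F_range[of \<theta> "X 1 \<omega>"] \<phi>_range[OF X_D[OF one that]] f_D[OF X_D[OF one that]]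
        unfolding atLeastAtMost_iff by linarith
      then have "AE \<omega> in P. norm ((F \<theta> (X 1 \<omega>) - f (X 1 \<omega>))\<^sup>2) \<le> (v - u)\<^sup>2"
        by (intro AE_I2) (simp add: abs_le_square_iff)
      moreover note [measurable] = X1 F_meas[of \<theta>] f_meas
      have "(\<lambda>\<omega>. (F \<theta> (X 1 \<omega>) - f (X 1 \<omega>))\<^sup>2) \<in> borel_measurable P" by measurable
      ultimately show "integrable P (\<lambda>\<omega>. (F \<theta> (X 1 \<omega>) - f (X 1 \<omega>))\<^sup>2)"
        by (rule integrable_const_bound)
    qed simp
    finally show ?thesis .
  qed

  \<comment> \<open>The selected sample and the final estimate\<close>
  define \<kappa> where "\<kappa> \<omega> = (LEAST k. k \<in> {1..K} \<and> \<E> (\<Theta> k \<omega>) \<omega> = Min ((\<lambda>j. \<E> (\<Theta> j \<omega>) \<omega>) ` {1..K}))" for \<omega>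
  have \<kappa>: "\<kappa> \<omega> \<in> {1..K}" "\<E> (\<Theta> (\<kappa> \<omega>) \<omega>) \<omega> = Min ((\<lambda>j. \<E> (\<Theta> j \<omega>) \<omega>) ` {1..K})" for \<omega>
  proof -
    have "Min ((\<lambda>j. \<E> (\<Theta> j \<omega>) \<omega>) ` {1..K}) \<in> (\<lambda>j. \<E> (\<Theta> j \<omega>) \<omega>) ` {1..K}"
      using pos by (intro Min_in) auto
    then obtain j where "j \<in> {1..K}" "Min ((\<lambda>j. \<E> (\<Theta> j \<omega>) \<omega>) ` {1..K}) = \<E> (\<Theta> j \<omega>) \<omega>"
      by (rule imageE)
    then have "\<exists>k. k \<in> {1..K} \<and> \<E> (\<Theta> k \<omega>) \<omega> = Min ((\<lambda>j. \<E> (\<Theta> j \<omega>) \<omega>) ` {1..K})"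
      by (intro exI[of _ j]) simp
    from LeastI_ex[OF this] show "\<kappa> \<omega> \<in> {1..K}"
      "\<E> (\<Theta> (\<kappa> \<omega>) \<omega>) \<omega> = Min ((\<lambda>j. \<E> (\<Theta> j \<omega>) \<omega>) ` {1..K})"
      unfolding \<kappa>_def by blast+
  qed
  have \<kappa>_le: "\<E> (\<Theta> (\<kappa> \<omega>) \<omega>) \<omega> \<le> \<E> (\<Theta> k \<omega>) \<omega>" if "k \<in> {1..K}" for k \<omega>
    unfolding \<kappa>(2) using that by (intro Min_le) auto
  have \<E>_F: "\<E> \<theta> \<omega> = (\<Sum>m=1..M. (F \<theta> (X m \<omega>) - Y m \<omega>)\<^sup>2) / real M" for \<theta> \<omega>
    by (simp add: \<E>_def F_def)
  have \<Lambda>: "0 < \<Lambda>" using l_gt R(1) by (simp add: \<Lambda>_def)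
  have bound: "prob {\<omega> \<in> space P. expectation (\<lambda>\<omega>'. (F (\<Theta> (\<kappa> \<omega>) \<omega>) (X 1 \<omega>') - f (X 1 \<omega>'))\<^sup>2) > \<epsilon>\<^sup>2}
    \<le> exp (- real K * min 1 ((\<epsilon>\<^sup>2 / (16 * (v - u) * \<Lambda> * R)) ^ card {1..dd})) +
      2 * exp (real (card {1..dd}) * ln (max 1 (128 * \<Lambda> * R * (v - u) / \<epsilon>\<^sup>2)) - \<epsilon> ^ 4 * real M / (32 * (v - u) ^ 4))"
  proof (rule random_search_risk_bound[where D = D and S = S and Y = Y and \<eta> = \<eta> and K = K])
    show "\<bar>F \<theta> x - F \<eta> x\<bar> \<le> \<Lambda> * \<rho>"
      if "\<theta> \<in> PiE {1..dd} (\<lambda>_. {-R..R})" "\<eta> \<in> PiE {1..dd} (\<lambda>_. {-R..R})" "x \<in> D" "0 \<le> \<rho>"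
        "\<And>i. i \<in> {1..dd} \<Longrightarrow> \<bar>\<theta> i - \<eta> i\<bar> \<le> \<rho>" for \<theta> \<eta> x \<rho>
      unfolding F_def \<Lambda>_def
      by (rule clipped_net_lipschitz[where dd = dd]) (use that R(1) l_gt D_R ll_w ll_dd ll_0 ll_l in auto)
    show "AE \<omega> in P. f (X 1 \<omega>) = real_cond_exp P (vimage_algebra (space P) (X 1) S) (Y 1) \<omega>"
      using \<phi>_condexp AE_space unfolding S_def[symmetric]
      by eventually_elim (simp add: f_D X_D[OF one] del: One_nat_def)
    show "\<bar>F \<eta> x - f x\<bar> \<le> \<epsilon> / 2" if "x \<in> D" for x
      using \<eta>(2)[OF that] by (simp add: F_def f_D[OF that])
    show "(\<Sum>m=1..M. (F (\<Theta> (\<kappa> \<omega>) \<omega>) (X m \<omega>) - Y m \<omega>)\<^sup>2) / real M \<le>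
        (\<Sum>m=1..M. (F (\<Theta> k \<omega>) (X m \<omega>) - Y m \<omega>)\<^sup>2) / real M" if "k \<in> {1..K}" for \<omega> k
      using \<kappa>_le[OF that] unfolding \<E>_F .
    show "indep_vars (\<lambda>_. S \<Otimes>\<^sub>M borel) (\<lambda>m \<omega>. (X m \<omega>, Y m \<omega>)) {1..M}"
      using XY_indep unfolding S_def .
    show "distr P (S \<Otimes>\<^sub>M borel) (\<lambda>\<omega>. (X m \<omega>, Y m \<omega>)) = distr P (S \<Otimes>\<^sub>M borel) (\<lambda>\<omega>. (X 1 \<omega>, Y 1 \<omega>))"
      if "m \<in> {1..M}" for m using XY_ident[OF that] unfolding S_def .
    show "f x \<in> {u..v}" if "x \<in> D" for x unfolding f_D[OF that] by (rule \<phi>_range[OF that])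
    show "0 < R" using R(1) by simp
    show "\<Theta> k \<omega> \<in> PiE {1..dd} (\<lambda>_. {-R..R})" if "k \<in> {1..K}" "\<omega> \<in> space P" for k \<omega>
      using \<Theta>_B[OF that] unfolding B_def .
    show "F \<theta> \<in> borel_measurable S" for \<theta> by (rule F_meas)
    show "F \<theta> x \<in> {u..v}" for \<theta> x by (rule F_range)
    show "\<kappa> \<omega> \<in> {1..K}" for \<omega> by (rule \<kappa>(1))
    show "finite {1..dd}" by simp
  qed (fact pos eps uv \<Lambda> X_D Y_uv f_meas \<eta>(1) \<Theta>_indep \<Theta>_ident \<Theta>_unif[unfolded B_def])+
  \<comment> \<open>\<open>\<Lambda>\<close> contributes \<open>R ^ l\<close>; the further factor
    \<open>R\<close> comes from the side length \<open>2 * R\<close> of the parameter cube.\<close>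
  have constants: "16 * (v - u) * \<Lambda> * R = 16 * (v - u) * real l * (real w + 1) ^ l * R ^ (l + 1)"
    "128 * \<Lambda> * R * (v - u) = 128 * real l * (real w + 1) ^ l * R ^ (l + 1) * (v - u)"
    "(\<epsilon>\<^sup>2 / z) ^ dd = \<epsilon> ^ (2 * dd) / z ^ dd" "card {1..dd} = dd" for z
    by (simp_all add: \<Lambda>_def power_divide power_mult)
  have less: "ennreal (\<epsilon>\<^sup>2) < ennreal (expectation (\<lambda>\<omega>'. (F \<theta> (X 1 \<omega>') - f (X 1 \<omega>'))\<^sup>2)) \<longleftrightarrow>
      \<epsilon>\<^sup>2 < expectation (\<lambda>\<omega>'. (F \<theta> (X 1 \<omega>') - f (X 1 \<omega>'))\<^sup>2)" for \<theta>
    by (rule ennreal_less_iff) simp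
  have \<Xi>: "\<Xi> \<omega> = \<Theta> (\<kappa> \<omega>) \<omega>" for \<omega> by (simp add: \<Xi>_def \<kappa>_def)
  show ?thesis
    unfolding S_def[symmetric] risk less \<Xi> w_def[symmetric] by (rule bound[unfolded constants])
qed

end
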